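(* Let $T$ be a uniformly recurrent tree set over a finite alphabet $A$, with $A\subset T$. Then $T$ has a primitive $\mathcal{S}_e$-adic representation, where $\mathcal{S}_e$ is the set of elementary positive automorphisms on $A$. That is, there is a sequence $(\sigma_n)_{n\in\mathbb{N}}$ of elements of $\mathcal{S}_e$ (viewed as morphisms $A^*\to A^*$) which is primitive and satisfies $$T=\bigcap_{n\in\mathbb{N}}\mathrm{Fac}(\sigma_0\sigma_1\cdots\sigma_n(A^* )).$$
   Context: Words and sets. $A^*$ is the free monoid of finite words over the finite nonempty alphabet $A$. A set $T$ of words is factorial if it contains all factors of its elements. A factorial set $T$ is right-extendable if for every $w\in T$ there is a letter $a$ with $wa\in T$, and biextendable if for every $w\in T$ there are letters $a,b$ with $awb\in T$. A set $T$ is uniformly recurrent if it is (nonempty) factorial and right-extendable and for every $u\in T$ there is $n\ge 1$ such that $u$ is a factor of every word of $T$ of length $n$. Tree sets. For a factorial set $T$ and $w\in T$, let $L(w)=\{a\in A\mid aw\in T\}$, $R(w)=\{a\in A\mid wa\in T\}$, $E(w)=\{(a,b)\in A\times A\mid awb\in T\}$. The extension graph $G(w)$ is the undirected graph whose vertex set is the disjoint union of $L(w)$ and $R(w)$ and whose edges are the pairs $(a,b)\in E(w)$ (joining $a\in L(w)$ to $b\in R(w)$). $T$ is a tree set if it is factorial, biextendable, and for every $w\in T$ (including the empty word) the graph $G(w)$ is a tree, i.e. connected and acyclic. Elementary positive automorphisms. For $a,b\in A$ with $a\neq b$, let $\alpha_{a,b}$ be the automorphism of the free group on $A$ with $a\mapsto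 ab$ and $c\mapsto c$ for every letter $c\ne a$, and let $\tilde\alpha_{a,b}$ be the one with $a\mapsto ba$ and $c\mapsto c$ for every letter $c\neq a$. The elementary positive automorphisms on $A$ are all $\alpha_{a,b}$, $\tilde\alpha_{a,b}$ ($a\neq b$) together with the automorphisms induced by permutations of $A$; each restricts to a morphism $A^*\to A^*$. $S$-adic representations. For a set $W$ of words, $\mathrm{Fac}(W)$ is the set of factors of words of $W$. For a set $\mathcal{S}$ of morphisms, an $\mathcal{S}$-adic representation of a factorial set $T\subset A^*$ is a sequence $(\sigma_n)_{n\in\mathbb{N}}$ of elements of $\mathcal{S}$, $\sigma_n:A_{n+1}^*\to A_n^*$, $A_0=A$, such that $T=\bigcap_{n}\mathrm{Fac}(\sigma_0\cdots\sigma_n(A_{n+1}^* ))$. The sequence is primitive if for every $r\ge 0$ there is $s>r$ such that every letter of $A_r$ occurs in every word $\sigma_r\cdots\sigma_{s-1}(a)$, $a\in A_s$. Here all $A_n=A$. *)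

theory Defs
  imports Main "HOL-Library.Sublist"
begin

text \<open>
  The alphabet \<open>A\<close> is the (finite, automatically nonempty) type \<open>'a\<close>; words over \<open>A\<close> are
  lists, so \<open>A\<^sup>*\<close> is the universe of \<open>'a list\<close>. The factor order is \<^const>\<open>sublist\<close>
  (contiguous, not \<^const>\<open>subseq\<close>).
\<close>

subsection \<open>Sets of words\<close>

definition Fac :: "'a list set \<Rightarrow> 'a list set" where
  "Fac W = {u. \<exists>w\<in>W. sublist u w}"

definition factorial :: "'a list set \<Rightarrow> bool" where
  "factorial T \<longleftrightarrow> (\<forall>w\<in>T. \<forall>u. sublist u w \<longrightarrow> u \<in> T)"

definition right_extendable :: "'a list set \<Rightarrow> bool" where
  "right_extendable T \<longleftrightarrow> (\<forall>w\<in>T. \<exists>a. w @ [a] \<in> T)"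

definition biextendable :: "'a list set \<Rightarrow> bool" where
  "biextendable T \<longleftrightarrow> (\<forall>w\<in>T. \<exists>a b. [a] @ w @ [b] \<in> T)"

definition uniformly_recurrent :: "'a list set \<Rightarrow> bool" where
  "uniformly_recurrent T \<longleftrightarrow>
     T \<noteq> {} \<and> factorial T \<and> right_extendable T \<and>
     (\<forall>u\<in>T. \<exists>n\<ge>1. \<forall>w\<in>T. length w = n \<longrightarrow> sublist u w)"

subsection \<open>Undirected trees\<close>

text \<open>
  A simple undirected graph is given by its vertex set \<open>V\<close> and a set \<open>E\<close> of two-element edges.
  A cycle is listed by its distinct vertices (at least three), without repeating the first one
  at the end.
\<close>

definition ugraph_connected :: "'v set \<Rightarrow> 'v set set \<Rightarrow> bool" where
  "ugraph_connected V E \<longleftrightarrow>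
     V \<noteq> {} \<and> (\<forall>u\<in>V. \<forall>v\<in>V. (u, v) \<in> {(x, y). {x, y} \<in> E}\<^sup>*)"

definition ugraph_cycle :: "'v set set \<Rightarrow> 'v list \<Rightarrow> bool" where
  "ugraph_cycle E p \<longleftrightarrow>
     3 \<le> length p \<and> distinct p \<and>
     (\<forall>i<length p. {p ! i, p ! (Suc i mod length p)} \<in> E)"

definition ugraph_tree :: "'v set \<Rightarrow> 'v set set \<Rightarrow> bool" where
  "ugraph_tree V E \<longleftrightarrow> ugraph_connected V E \<and> (\<nexists>p. ugraph_cycle E p)"

subsection \<open>Extension graphs and tree sets\<close>

definition left_ext :: "'a list set \<Rightarrow> 'a list \<Rightarrow> 'a set" where
  "left_ext T w = {a. [a] @ w \<in> T}"

definition right_ext :: "'a list set \<Rightarrow> 'a list \<Rightarrow> 'a set" where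
  "right_ext T w = {a. w @ [a] \<in> T}"

definition two_sided_ext :: "'a list set \<Rightarrow> 'a list \<Rightarrow> ('a \<times> 'a) set" where
  "two_sided_ext T w = {(a, b). [a] @ w @ [b] \<in> T}"

definition ext_graph_verts :: "'a list set \<Rightarrow> 'a list \<Rightarrow> ('a + 'a) set" where
  "ext_graph_verts T w = left_ext T w <+> right_ext T w"

definition ext_graph_edges :: "'a list set \<Rightarrow> 'a list \<Rightarrow> ('a + 'a) set set" where
  "ext_graph_edges T w = {{Inl a, Inr b} | a b. (a, b) \<in> two_sided_ext T w}"

definition tree_set :: "'a list set \<Rightarrow> bool" where
  "tree_set T \<longleftrightarrow>
     factorial T \<and> biextendable T \<and>
     (\<forall>w\<in>T. ugraph_tree (ext_graph_verts T w) (ext_graph_edges T w))"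

subsection \<open>Elementary positive automorphisms\<close>

text \<open>
  A positive automorphism of the free group on \<open>A\<close> sends every letter to a word of \<open>A\<^sup>*\<close>.
  It is represented by its restriction to \<open>A\<^sup>*\<close>, that is, by the monoid morphism with the same
  images of letters.
\<close>

definition word_morphism :: "('a \<Rightarrow> 'b list) \<Rightarrow> 'a list \<Rightarrow> 'b list" where
  "word_morphism h w = concat (map h w)"

lemma word_morphism_unique:
  assumes "\<And>u v. f (u @ v) = f u @ f v" and "\<And>c. f [c] = h c"
  shows "f = word_morphism h"
proof
  fix w
  have "f [] = []"
    using assms(1)[of "[]" "[]"] by simp
  then show "f w = word_morphism h w"
  proof (induction w)
    case (Cons c w)
    then show ?case
      using assms(1)[of "[c]" w] assms(2)[of c] by (simp add: word_morphism_def)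
  qed (simp add: word_morphism_def)
qed

definition elem_alpha :: "'a \<Rightarrow> 'a \<Rightarrow> 'a list \<Rightarrow> 'a list" where
  "elem_alpha a b = word_morphism (\<lambda>c. if c = a then [a, b] else [c])"

definition elem_alpha_tilde :: "'a \<Rightarrow> 'a \<Rightarrow> 'a list \<Rightarrow> 'a list" where
  "elem_alpha_tilde a b = word_morphism (\<lambda>c. if c = a then [b, a] else [c])"

definition perm_morphism :: "('a \<Rightarrow> 'a) \<Rightarrow> 'a list \<Rightarrow> 'a list" where
  "perm_morphism \<pi> = word_morphism (\<lambda>c. [\<pi> c])"

definition elementary_positive :: "('a list \<Rightarrow> 'a list) set" where
  "elementary_positive =
     {elem_alpha a b | a b. a \<noteq> b} \<union>
     {elem_alpha_tilde a b | a b. a \<noteq> b} \<union>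
     {perm_morphism \<pi> | \<pi>. bij \<pi>}"

subsection \<open>S-adic representations\<close>

text \<open>
  \<open>morphism_prod \<sigma> r s\<close> is \<open>\<sigma>\<^sub>r \<circ> \<sigma>\<^sub>r\<^sub>+\<^sub>1 \<circ> \<dots> \<circ> \<sigma>\<^sub>s\<^sub>-\<^sub>1\<close>: the upper index is excluded. All alphabets
  \<open>A\<^sub>n\<close> of the representation are equal to \<open>A\<close>.
\<close>

definition morphism_prod ::
  "(nat \<Rightarrow> 'a list \<Rightarrow> 'a list) \<Rightarrow> nat \<Rightarrow> nat \<Rightarrow> 'a list \<Rightarrow> 'a list" where
  "morphism_prod \<sigma> r s = foldr (\<circ>) (map \<sigma> [r..<s]) id"

definition sadic_representation ::
  "('a list \<Rightarrow> 'a list) set \<Rightarrow> 'a list set \<Rightarrow> (nat \<Rightarrow> 'a list \<Rightarrow> 'a list) \<Rightarrow> bool" where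
  "sadic_representation S T \<sigma> \<longleftrightarrow>
     (\<forall>n. \<sigma> n \<in> S) \<and> T = (\<Inter>n. Fac (range (morphism_prod \<sigma> 0 (Suc n))))"

definition primitive_sequence :: "(nat \<Rightarrow> 'a list \<Rightarrow> 'a list) \<Rightarrow> bool" where
  "primitive_sequence \<sigma> \<longleftrightarrow>
     (\<forall>r. \<exists>s>r. \<forall>a b. b \<in> set (morphism_prod \<sigma> r s [a]))"

end

theory Submission
  imports Defs
begin

text \<open>
  If \<open>x\<close> is always followed by \<open>y \<noteq> x\<close> in a tree set \<open>T\<close>, then \<open>T\<close> is desubstituted by
  \<open>\<alpha>\<^sub>x\<^sub>,\<^sub>y\<close>. In the extension graphs this splits the left vertex \<open>y\<close> into \<open>x\<close> and \<open>y\<close>, and the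
  result is a tree set again whenever \<open>x\<close> is not a cut vertex of the hypergraphs formed by the
  left extensions of the words \<open>y u\<close>, \<open>u\<close> of a fixed length; a count shows that suitable letters
  exist. Fix a letter \<open>a\<close> and call a letter marked if its image under the moves made so far starts
  with \<open>a\<close>; the other images do not contain \<open>a\<close>. Moves that append an unmarked letter
  (\<open>x \<mapsto> x y\<close>, \<open>y\<close> unmarked), or the mirror moves \<open>y \<mapsto> x y\<close> of an unmarked \<open>y\<close>, are possible as long as
  an unmarked letter is left: collapse the marked right vertices of the extension graph of the
  empty word to a root and look at the neighbours of the parent of a deepest vertex. Image lengths
  are bounded by uniform recurrence, so after finitely many moves all images start with \<open>a\<close>.
  Repeat with the desubstituted set. The image lengths tend to infinity because high powers of
  \<open>a\<close> do not occur, and this gives primitivity. Since all block images start with \<open>a\<close>, all words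
  of length two in the images of arbitrary words belong to the language, and the intersection is
  exactly \<open>T\<close>.
\<close>

subsection \<open>Bipartite graphs as relations\<close>

text \<open>
  A bipartite graph without isolated vertices is given by its edge relation: the left vertices are
  its domain, the right vertices its range. Two right vertices are adjacent if they have a common
  neighbour; \<open>conn S\<close> says that the subgraph induced by the right vertices in \<open>S\<close> and their
  neighbours is connected.
\<close>

definition adj :: "'b set \<Rightarrow> ('a \<times> 'b) set \<Rightarrow> ('b \<times> 'b) set" where
  "adj S E = {(r, r'). r \<in> S \<and> r' \<in> S \<and> (\<exists>l. (l, r) \<in> E \<and> (l, r') \<in> E)}"

definition conn :: "'b set \<Rightarrow> ('a \<times> 'b) set \<Rightarrow> bool" where
  "conn S E \<longleftrightarrow> (\<forall>r \<in> S \<inter> Range E. \<forall>r' \<in> S \<inter> Range E. (r, r') \<in> (adj S E)\<^sup>*)"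

text \<open>For finite nonempty connected graphs \<open>card_conn_ge\<close> is the reverse
  inequality, so this is the Euler characterization of trees. It is easier to carry through changes
  of the graph than the absence of cycles, and it forces \<open>E\<close> to be nonempty.\<close>

definition gtree :: "('a \<times> 'b) set \<Rightarrow> bool" where
  "gtree E \<longleftrightarrow> conn UNIV E \<and> card E + 1 \<le> card (Domain E) + card (Range E)"

lemma connD: "conn S E \<Longrightarrow> r \<in> S \<Longrightarrow> r \<in> Range E \<Longrightarrow> r' \<in> S \<Longrightarrow> r' \<in> Range E \<Longrightarrow> (r, r') \<in> (adj S E)\<^sup>*"
  unfolding conn_def by blast

lemma conn_singleton: "conn {z} E"
  unfolding conn_def by auto

lemma rtrancl_cut:
  assumes "(a, b) \<in> R\<^sup>*" "P a" "\<not> P b"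
  shows "\<exists>u v. (u, v) \<in> R \<and> P u \<and> \<not> P v"
  using assms by (induction rule: rtrancl_induct) blast+

text \<open>Along a path of right vertices, the left vertices used by consecutive steps share a
  right vertex, so they form a path on the left side.\<close>

lemma conn_converse:
  assumes "conn UNIV E"
  shows "conn UNIV (E\<inverse>)"
proof -
  have "(l, l') \<in> (adj UNIV (E\<inverse>))\<^sup>*" if "(l, r) \<in> E" "(l', r') \<in> E" for l l' r r'
  proof -
    have "(r, r') \<in> (adj UNIV E)\<^sup>*"
      using assms that by (intro connD) auto
    then have "\<forall>l'. (l', r') \<in> E \<longrightarrow> (l, l') \<in> (adj UNIV (E\<inverse>))\<^sup>*"
    proof (induction rule: rtrancl_induct)
      case base
      then show ?case using that by (auto simp: adj_def)
    next
      case (step s s')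
      then obtain k where k: "(k, s) \<in> E" "(k, s') \<in> E" by (auto simp: adj_def)
      show ?case
      proof (intro allI impI)
        fix l' assume "(l', s') \<in> E"
        then have "(k, l') \<in> adj UNIV (E\<inverse>)" using k by (auto simp: adj_def)
        then show "(l, l') \<in> (adj UNIV (E\<inverse>))\<^sup>*" using step.IH k by auto
      qed
    qed
    then show ?thesis using that by blast
  qed
  then show ?thesis unfolding conn_def by auto
qed

lemma gtree_converse: "gtree E \<Longrightarrow> gtree (E\<inverse>)"
  unfolding gtree_def by (simp add: conn_converse)

text \<open>A path of left vertices from \<open>x\<close> to \<open>c\<close> has a step that leaves
  \<open>x\<close>; the right vertex used by this step is shared.\<close>

lemma conn_shared:
  assumes "conn UNIV E" "(x, r) \<in> E" "(c, r') \<in> E" "c \<noteq> x"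
  shows "\<exists>s d. (x, s) \<in> E \<and> (d, s) \<in> E \<and> d \<noteq> x"
proof -
  have "(x, c) \<in> (adj UNIV (E\<inverse>))\<^sup>*"
    using assms by (intro connD conn_converse) auto
  from rtrancl_cut[OF this, of "\<lambda>l. l = x"] assms(4)
  show ?thesis by (auto simp: adj_def)
qed

text \<open>In a tree, \<open>thin\<close> means that deleting \<open>x\<close> and the leaves at \<open>x\<close> keeps the rest connected.\<close>

definition thin :: "'a \<Rightarrow> ('a \<times> 'b) set \<Rightarrow> bool" where
  "thin x E \<longleftrightarrow> (\<forall>r r' c c'. (x, r) \<in> E \<longrightarrow> (x, r') \<in> E \<longrightarrow> (c, r) \<in> E \<longrightarrow> (c', r') \<in> E
      \<longrightarrow> c \<noteq> x \<longrightarrow> c' \<noteq> x \<longrightarrow> r = r')"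

definition del :: "'a \<Rightarrow> ('a \<times> 'b) set \<Rightarrow> ('a \<times> 'b) set" where
  "del x E = {(l, r) \<in> E. l \<noteq> x}"

text \<open>
  The right neighbours of \<open>y\<close> are distributed over \<open>x\<close> and \<open>y\<close> as prescribed by \<open>F\<close>; a vertex \<open>x\<close>
  of \<open>E\<close> is discarded.
\<close>

definition split_vertex :: "'a \<Rightarrow> 'a \<Rightarrow> ('a \<times> 'b) set \<Rightarrow> ('a \<times> 'b) set \<Rightarrow> ('a \<times> 'b) set" where
  "split_vertex x y E F = {(l, r) \<in> E. l \<noteq> x \<and> l \<noteq> y} \<union> {x} \<times> F `` {x} \<union> {y} \<times> F `` (- {x})"

text \<open>By thinness only one right neighbour of \<open>x\<close> can survive the deletion, so a
  detour of a path through \<open>x\<close> returns to the surviving vertex where it began and can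
  be cut out.\<close>

lemma conn_del:
  assumes "conn S E" "thin x E"
  shows "conn S (del x E)"
proof -
  have thinD: "r = r'" if "(x, r) \<in> E" "(x, r') \<in> E" "r \<in> Range (del x E)" "r' \<in> Range (del x E)" for r r'
    using assms(2) that unfolding thin_def del_def by blast
  have "(r, r') \<in> (adj S (del x E))\<^sup>*"
    if r: "r \<in> S" "r \<in> Range (del x E)" and r': "r' \<in> S" "r' \<in> Range (del x E)" for r r'
  proof -
    have "(r, r') \<in> (adj S E)\<^sup>*"
      using r r' assms(1) by (intro connD) (auto simp: del_def)
    \<comment> \<open>\<open>s\<close> is the last surviving vertex of the path: its current end is
      \<open>s\<close> itself, or both are neighbours of \<open>x\<close>.\<close>
    then have "\<exists>s. (r, s) \<in> (adj S (del x E))\<^sup>* \<and> s \<in> Range (del x E) \<and> (s = r' \<or> (x, s) \<in> E \<and> (x, r') \<in> E)"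
    proof (induction rule: rtrancl_induct)
      case base
      then show ?case using r by blast
    next
      case (step t u)
      then obtain s where s: "(r, s) \<in> (adj S (del x E))\<^sup>*" "s \<in> Range (del x E)"
        "s = t \<or> (x, s) \<in> E \<and> (x, t) \<in> E" by blast
      from step(2) obtain l where l: "(l, t) \<in> E" "(l, u) \<in> E" "t \<in> S" "u \<in> S" by (auto simp: adj_def)
      show ?case
      proof (cases "l = x")
        case True
        then show ?thesis using s l by blast
      next
        case False
        then have t: "(l, t) \<in> del x E" "(l, u) \<in> del x E" using l by (auto simp: del_def)
        then have "s = t" using s thinD by blast
        moreover have "(t, u) \<in> adj S (del x E)" using t l by (auto simp: adj_def)
        ultimately have "(r, u) \<in> (adj S (del x E))\<^sup>*" using s by (simp add: rtrancl.rtrancl_into_rtrancl)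
        then show ?thesis using t by blast
      qed
    qed
    then show ?thesis using thinD r' by blast
  qed
  then show ?thesis unfolding conn_def by blast
qed

text \<open>The deletion removes \<open>card ?N\<close> edges, one left vertex and at most
  \<open>card ?N - 1\<close> right vertices, since the neighbour \<open>s\<close> that
  \<open>x\<close> shares with another left vertex survives.\<close>

lemma gtree_del:
  assumes "finite E" "gtree E" "thin x E" "del x E \<noteq> {}"
  shows "gtree (del x E)"
proof (cases "x \<in> Domain E")
  case False
  then have "del x E = E" by (auto simp: del_def)
  then show ?thesis using assms by simp
next
  case True
  let ?D = "del x E" and ?N = "E `` {x}"
  obtain c r' where "(c, r') \<in> E" "c \<noteq> x" using assms(4) by (auto simp: del_def)
  with True obtain s d where s: "(x, s) \<in> E" "(d, s) \<in> E" "d \<noteq> x"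
    using conn_shared[of E x] assms(2) unfolding gtree_def by blast
  have fin: "finite ?N" "finite (Domain E)" "finite (Range E)" using assms(1) by (auto intro: finite_Image finite_Domain finite_Range)
  have E: "E = ?D \<union> {x} \<times> ?N" by (auto simp: del_def)
  have "card E = card ?D + card ({x} \<times> ?N)"
    by (subst E, rule card_Un_disjoint) (use assms(1) fin in \<open>auto simp: del_def intro: finite_subset[of _ E]\<close>)
  then have cE: "card E = card ?D + card ?N" by (simp add: card_cartesian_product)
  have "Domain E = insert x (Domain ?D)" using True by (auto simp: del_def)
  moreover have "x \<notin> Domain ?D" by (auto simp: del_def)
  moreover have finD: "finite ?D" using assms(1) by (auto simp: del_def intro: finite_subset[of _ E])
  ultimately have cD: "card (Domain E) = Suc (card (Domain ?D))" by (simp add: finite_Domain)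
  have "Range E = Range ?D \<union> (?N - {s})" using s by (auto simp: del_def)
  then have "card (Range E) \<le> card (Range ?D) + card (?N - {s})" by (simp add: card_Un_le)
  moreover have "card ?N = Suc (card (?N - {s}))" using s fin by (metis Image_singleton_iff card_Suc_Diff1)
  ultimately have "card ?D + 1 \<le> card (Domain ?D) + card (Range ?D)"
    using assms(2) cE cD unfolding gtree_def by linarith
  moreover have "conn UNIV (del x E)" using assms(2,3) by (auto simp: gtree_def intro: conn_del)
  ultimately show ?thesis unfolding gtree_def by blast
qed

lemma Range_split_vertex:
  assumes "Range F = E `` {y}" "x \<noteq> y"
  shows "Range (split_vertex x y E F) = Range (del x E)"
proof (intro set_eqI iffI)
  fix r assume "r \<in> Range (split_vertex x y E F)"
  then show "r \<in> Range (del x E)" using assms unfolding split_vertex_def del_def by auto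
next
  fix r assume "r \<in> Range (del x E)"
  then obtain l where l: "(l, r) \<in> E" "l \<noteq> x" by (auto simp: del_def)
  show "r \<in> Range (split_vertex x y E F)"
  proof (cases "l = y")
    case True
    then obtain c where "(c, r) \<in> F" using l assms(1) by blast
    then show ?thesis unfolding split_vertex_def by (cases "c = x") auto
  qed (use l in \<open>auto simp: split_vertex_def\<close>)
qed

text \<open>A step through the old vertex \<open>y\<close> joins two elements of
  \<open>Range F\<close> and is replaced by a path in \<open>F\<close>. Merging the left vertices of
  \<open>F\<close> into \<open>x\<close> and \<open>y\<close> keeps its adjacencies.\<close>

lemma conn_split_vertex:
  assumes "conn S E" "conn S F" "thin x E" "Range F = E `` {y}" "x \<noteq> y"
  shows "conn S (split_vertex x y E F)"
proof -
  let ?G = "split_vertex x y E F"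
  have "adj S F \<subseteq> adj S ?G"
  proof clarify
    fix r r' assume "(r, r') \<in> adj S F"
    then obtain c where "r \<in> S" "r' \<in> S" "(c, r) \<in> F" "(c, r') \<in> F" by (auto simp: adj_def)
    then show "(r, r') \<in> adj S ?G" unfolding adj_def split_vertex_def by (cases "c = x") auto
  qed
  then have F: "(adj S F)\<^sup>* \<subseteq> (adj S ?G)\<^sup>*" by (rule rtrancl_mono)
  have "adj S (del x E) \<subseteq> (adj S ?G)\<^sup>*"
  proof clarify
    fix r r' assume "(r, r') \<in> adj S (del x E)"
    then obtain c where c: "r \<in> S" "r' \<in> S" "(c, r) \<in> E" "(c, r') \<in> E" "c \<noteq> x" by (auto simp: adj_def del_def)
    show "(r, r') \<in> (adj S ?G)\<^sup>*"
    proof (cases "c = y")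
      case True
      then have "r \<in> Range F" "r' \<in> Range F" using c assms(4) by auto
      then show ?thesis using F connD[OF assms(2)] c by blast
    qed (use c in \<open>auto simp: adj_def split_vertex_def\<close>)
  qed
  then have "(adj S (del x E))\<^sup>* \<subseteq> (adj S ?G)\<^sup>*" by (metis rtrancl_idemp rtrancl_mono)
  moreover have "conn S (del x E)" using assms(1,3) by (rule conn_del)
  ultimately show ?thesis
    unfolding conn_def Range_split_vertex[OF assms(4,5)] by blast
qed

text \<open>Compared with \<open>del x E\<close>, the split adds
  \<open>card (?A \<inter> ?B)\<close> edges. This is at most 1 because \<open>F\<close> is thin at
  \<open>x\<close>; if it is 1, both halves of \<open>y\<close> are present and a left vertex is
  gained.\<close>

lemma gtree_split_vertex:
  assumes fin: "finite E" "finite F" and E: "gtree E" "thin x E" and F: "conn UNIV F" "thin x F"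
    and R: "Range F = E `` {y}" "x \<noteq> y" and ne: "split_vertex x y E F \<noteq> {}"
  shows "gtree (split_vertex x y E F)"
proof -
  let ?G = "split_vertex x y E F" and ?D = "del x E"
  let ?A = "F `` {x}" and ?B = "F `` (- {x})" and ?M = "{(l, r) \<in> E. l \<noteq> x \<and> l \<noteq> y}"
  have RG: "Range ?G = Range ?D" by (rule Range_split_vertex[OF R])
  have "?D \<noteq> {}" using RG ne by (metis Range_empty_iff)
  then have D: "card ?D + 1 \<le> card (Domain ?D) + card (Range ?D)"
    using gtree_del[OF fin(1) E] unfolding gtree_def by blast
  have finM: "finite ?M" using fin by (auto intro: finite_subset[of _ E])
  have finAB: "finite ?A" "finite ?B" using fin by (auto intro: finite_Image)
  have G: "card ?G = card ?M + card ?A + card ?B"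
  proof -
    have "card (?M \<union> {x} \<times> ?A \<union> {y} \<times> ?B) = card (?M \<union> {x} \<times> ?A) + card ({y} \<times> ?B)"
      by (rule card_Un_disjoint) (use finM finAB R in auto)
    also have "card (?M \<union> {x} \<times> ?A) = card ?M + card ({x} \<times> ?A)"
      by (rule card_Un_disjoint) (use finM finAB R in auto)
    finally show ?thesis by (simp add: split_vertex_def card_cartesian_product)
  qed
  have D': "card ?D = card ?M + card (Range F)"
  proof -
    have "?D = ?M \<union> {y} \<times> Range F" using R by (auto simp: del_def)
    moreover have "card (?M \<union> {y} \<times> Range F) = card ?M + card ({y} \<times> Range F)"
      by (rule card_Un_disjoint) (use finM fin finite_Range in auto)
    ultimately show ?thesis by (simp add: card_cartesian_product)
  qed
  have AB: "Range F = ?A \<union> ?B" by auto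
  then have cAB: "card (Range F) + card (?A \<inter> ?B) = card ?A + card ?B"
    using card_Un_Int[OF finAB] by simp
  have DM: "Domain ?D = Domain ?M \<union> (if Range F = {} then {} else {y})"
    using R by (auto simp: del_def)
  have DG: "Domain ?G = Domain ?M \<union> (if ?A = {} then {} else {x}) \<union> (if ?B = {} then {} else {y})"
    by (auto simp: split_vertex_def)
  have nin: "x \<notin> Domain ?M" "y \<notin> Domain ?M" and finDM: "finite (Domain ?M)"
    using finite_Domain[OF finM] by auto
  have "card (?A \<inter> ?B) + card (Domain ?D) \<le> card (Domain ?G)"
  proof (cases "?A = {} \<or> ?B = {}")
    case True
    then have "?A \<inter> ?B = {}" by blast
    moreover have "card (Domain ?D) \<le> card (Domain ?G)"
      unfolding DM DG using True AB nin finDM by (cases "?A = {}"; cases "?B = {}") auto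
    ultimately show ?thesis by simp
  next
    case False
    have "card (?A \<inter> ?B) \<le> 1"
      using F(2) finAB unfolding thin_def One_nat_def
      by (subst card_le_Suc0_iff_eq) (simp, blast)
    moreover have "card (Domain ?G) = card (Domain ?M) + 2"
      unfolding DG using False nin finDM R by simp
    moreover have "card (Domain ?D) \<le> card (Domain ?M) + 1"
      unfolding DM using nin finDM by simp
    ultimately show ?thesis by linarith
  qed
  then have "card ?G + 1 \<le> card (Domain ?G) + card (Range ?G)"
    unfolding RG using D G D' cAB by linarith
  moreover have "conn UNIV ?G"
    using E F R by (intro conn_split_vertex) (auto simp: gtree_def)
  ultimately show ?thesis unfolding gtree_def by blast
qed

text \<open>Here the split happens on the side that carries the marked set \<open>S\<close>.\<close>

lemma conn_split_vertex_converse: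
  assumes "conn S E" "conn UNIV F" "Domain F = E\<inverse> `` {y}" "x \<noteq> y" "x \<notin> S"
  shows "conn (if y \<in> S then insert x S else S) ((split_vertex x y (E\<inverse>) (F\<inverse>))\<inverse>)"
proof -
  let ?G = "(split_vertex x y (E\<inverse>) (F\<inverse>))\<inverse>" and ?S = "if y \<in> S then insert x S else S"
  \<comment> \<open>\<open>h\<close> merges the two halves of \<open>y\<close> again and sends edges
    of the split graph to edges of \<open>E\<close>; paths of \<open>E\<close> are lifted along
    it.\<close>
  define h where "h r = (if r = x then y else r)" for r
  have G: "(l, r) \<in> ?G \<longleftrightarrow> (r \<noteq> x \<and> r \<noteq> y \<and> (l, r) \<in> E) \<or> (r = x \<and> (l, x) \<in> F) \<or> (r = y \<and> (\<exists>c. c \<noteq> x \<and> (l, c) \<in> F))" for l r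
    using assms(4) unfolding split_vertex_def by auto
  have hG: "(l, h r) \<in> E" if "(l, r) \<in> ?G" for l r
    using that assms(3,4) unfolding G h_def by auto
  \<comment> \<open>If both halves occur, connectedness of \<open>F\<close> yields a left vertex
    that is joined to both.\<close>
  have xy: "(r, r') \<in> (adj ?S ?G)\<^sup>*" if "r \<in> ?S" "r \<in> Range ?G" "r' \<in> ?S" "r' \<in> Range ?G" "h r = h r'" for r r'
  proof (cases "r = r'")
    case False
    then have rr: "(r = x \<and> r' = y) \<or> (r = y \<and> r' = x)" using that by (auto simp: h_def split: if_splits)
    then have "x \<in> Range ?G" "y \<in> Range ?G" "x \<in> ?S" "y \<in> ?S" using that assms(5) by (auto split: if_splits)
    then obtain l l' c where "(l, x) \<in> F" "(l', c) \<in> F" "c \<noteq> x" unfolding G Range_iff using assms(4) by blast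
    then obtain s d where "(x, s) \<in> F\<inverse>" "(d, s) \<in> F\<inverse>" "d \<noteq> x"
      using conn_shared[OF conn_converse[OF assms(2)]] by (metis converse_iff)
    then have "(s, x) \<in> ?G" "(s, y) \<in> ?G" unfolding G by auto
    then have "(r, r') \<in> adj ?S ?G" using rr \<open>x \<in> ?S\<close> \<open>y \<in> ?S\<close> unfolding adj_def by blast
    then show ?thesis by blast
  qed simp
  have "(r, r') \<in> (adj ?S ?G)\<^sup>*" if r: "r \<in> ?S" "r \<in> Range ?G" and r': "r' \<in> ?S" "r' \<in> Range ?G" for r r'
  proof -
    have hS: "h q \<in> S" if "q \<in> ?S" for q using that assms(5) by (auto simp: h_def split: if_splits)
    have hR: "h q \<in> Range E" if "q \<in> Range ?G" for q using that hG by (metis Range_iff)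
    have "(h r, h r') \<in> (adj S E)\<^sup>*"
      by (rule connD[OF assms(1) hS hR hS hR]) (rule r r')+
    then have "\<forall>q. q \<in> ?S \<longrightarrow> q \<in> Range ?G \<longrightarrow> h q = h r' \<longrightarrow> (r, q) \<in> (adj ?S ?G)\<^sup>*"
    proof (induction rule: rtrancl_induct)
      case base
      then show ?case using xy r by metis
    next
      case (step s t)
      then obtain l where l: "s \<in> S" "t \<in> S" "(l, s) \<in> E" "(l, t) \<in> E" by (auto simp: adj_def)
      have lift: "\<exists>q. q \<in> ?S \<and> (l, q) \<in> ?G \<and> h q = u" if u: "u \<in> S" "(l, u) \<in> E" for u
      proof (cases "u = y")
        case True
        then obtain c where "(l, c) \<in> F" using u assms(3) by auto
        then have "(l, if c = x then x else y) \<in> ?G" unfolding G by auto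
        then show ?thesis using True u by (auto simp: h_def split: if_splits)
      next
        case False
        moreover have "u \<noteq> x" using u assms(5) by blast
        ultimately have "(l, u) \<in> ?G" "h u = u" unfolding G h_def using u False by simp_all
        moreover have "u \<in> ?S" using u by simp
        ultimately show ?thesis by blast
      qed
      obtain p where p: "p \<in> ?S" "(l, p) \<in> ?G" "h p = s" using lift l by metis
      obtain q where q: "q \<in> ?S" "(l, q) \<in> ?G" "h q = t" using lift l by metis
      have "(r, p) \<in> (adj ?S ?G)\<^sup>*" using step.IH p by blast
      moreover have "(p, q) \<in> adj ?S ?G" using p q unfolding adj_def by blast
      ultimately have rq: "(r, q) \<in> (adj ?S ?G)\<^sup>*" by simp
      show ?case
      proof (intro allI impI)
        fix q' assume "q' \<in> ?S" "q' \<in> Range ?G" "h q' = t"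
        then have "(q, q') \<in> (adj ?S ?G)\<^sup>*" using xy q by (metis RangeI)
        then show "(r, q') \<in> (adj ?S ?G)\<^sup>*" using rq by simp
      qed
    qed
    then show ?thesis using r' by blast
  qed
  then show ?thesis unfolding conn_def by blast
qed

subsection \<open>Collapsing and distances in trees\<close>

text \<open>\<open>\<delta> r\<close> is half the distance of the right vertex \<open>r\<close> from
  the root \<open>z\<close>, and the left vertex \<open>l\<close> has distance
  \<open>2 * \<mu> l + 1\<close>. So \<open>\<delta> r = \<mu> l\<close> says that \<open>r\<close>
  is a parent of \<open>l\<close>, and \<open>\<delta> r = Suc (\<mu> l)\<close> that it is a
  child.\<close>

lemma conn_distances:
  assumes "conn UNIV E" "z \<in> Range E"
  obtains \<delta> \<mu> :: "_ \<Rightarrow> nat" where "\<delta> z = 0"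
    "\<And>l r. (l, r) \<in> E \<Longrightarrow> \<delta> r = \<mu> l \<or> \<delta> r = Suc (\<mu> l)"
    "\<And>l. l \<in> Domain E \<Longrightarrow> \<exists>r. (l, r) \<in> E \<and> \<delta> r = \<mu> l"
    "\<And>r. r \<in> Range E \<Longrightarrow> r \<noteq> z \<Longrightarrow> \<exists>l. (l, r) \<in> E \<and> \<delta> r = Suc (\<mu> l)"
proof -
  let ?R = "adj UNIV E"
  define \<delta> where "\<delta> r = (LEAST n. (z, r) \<in> ?R ^^ n)" for r
  define \<mu> where "\<mu> l = (LEAST n. \<exists>r. (l, r) \<in> E \<and> \<delta> r = n)" for l
  have reach: "(z, r) \<in> ?R ^^ \<delta> r" if "r \<in> Range E" for r
  proof -
    have "(z, r) \<in> ?R\<^sup>*" using assms that by (intro connD) auto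
    then obtain n where "(z, r) \<in> ?R ^^ n" using rtrancl_imp_relpow by blast
    then show ?thesis unfolding \<delta>_def by (rule LeastI)
  qed
  have \<delta>_le: "\<delta> r \<le> n" if "(z, r) \<in> ?R ^^ n" for r n
    unfolding \<delta>_def using that by (rule Least_le)
  have \<mu>_ex: "\<exists>r. (l, r) \<in> E \<and> \<delta> r = \<mu> l" if "l \<in> Domain E" for l
    unfolding \<mu>_def by (rule LeastI_ex) (use that in blast)
  have \<mu>_le: "\<mu> l \<le> \<delta> r" if "(l, r) \<in> E" for l r
    unfolding \<mu>_def by (rule Least_le) (use that in blast)
  have \<delta>_Suc: "\<delta> r \<le> Suc (\<mu> l)" if lr: "(l, r) \<in> E" for l r
  proof -
    obtain r' where r': "(l, r') \<in> E" "\<delta> r' = \<mu> l" using \<mu>_ex[OF DomainI[OF lr]] by blast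
    then have "(z, r') \<in> ?R ^^ \<mu> l" using reach by (metis RangeI)
    moreover have "(r', r) \<in> ?R" using r' lr by (auto simp: adj_def)
    ultimately show ?thesis by (intro \<delta>_le) auto
  qed
  show ?thesis
  proof (rule that[of \<delta> \<mu>])
    show "\<delta> z = 0" using \<delta>_le[of z 0] by simp
    show "\<delta> r = \<mu> l \<or> \<delta> r = Suc (\<mu> l)" if "(l, r) \<in> E" for l r
      using \<mu>_le[OF that] \<delta>_Suc[OF that] by linarith
    show "\<exists>r. (l, r) \<in> E \<and> \<delta> r = \<mu> l" if "l \<in> Domain E" for l using \<mu>_ex that .
    show "\<exists>l. (l, r) \<in> E \<and> \<delta> r = Suc (\<mu> l)" if "r \<in> Range E" "r \<noteq> z" for r
    proof -
      have "\<delta> r \<noteq> 0" using reach[OF that(1)] that(2) by (intro notI) simp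
      then obtain n where n: "\<delta> r = Suc n" by (cases "\<delta> r") auto
      then have "(z, r) \<in> ?R ^^ Suc n" using reach that by metis
      then obtain s where "(z, s) \<in> ?R ^^ n" "(s, r) \<in> ?R" by auto
      then obtain l where l: "(l, s) \<in> E" "(l, r) \<in> E" "\<delta> s \<le> n" using \<delta>_le by (auto simp: adj_def)
      then have "\<mu> l \<le> n" using \<mu>_le by (meson le_trans)
      then show ?thesis using l n \<delta>_Suc[OF l(2)] by (metis Suc_le_mono le_antisym)
    qed
  qed
qed

text \<open>
  In a finite connected graph every vertex except the root \<open>z\<close> has an edge that leads closer to
  \<open>z\<close>. These edges are pairwise distinct, so a graph with few edges has no others.
\<close>

lemma conn_parents:
  assumes fin: "finite E" and conn: "conn UNIV E" "z \<in> Range E"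
  obtains \<delta> \<mu> :: "_ \<Rightarrow> nat" where "\<delta> z = 0"
    "\<And>l r. (l, r) \<in> E \<Longrightarrow> \<delta> r = \<mu> l \<or> \<delta> r = Suc (\<mu> l)"
    "\<And>l. l \<in> Domain E \<Longrightarrow> \<exists>r. (l, r) \<in> E \<and> \<delta> r = \<mu> l"
    "\<And>r. r \<in> Range E \<Longrightarrow> r \<noteq> z \<Longrightarrow> \<exists>l. (l, r) \<in> E \<and> \<delta> r = Suc (\<mu> l)"
    "card (Domain E) + card (Range E) \<le> card E + 1"
    "\<And>l r r'. gtree E \<Longrightarrow> (l, r) \<in> E \<Longrightarrow> (l, r') \<in> E \<Longrightarrow> \<delta> r = \<mu> l \<Longrightarrow> \<delta> r' = \<mu> l \<Longrightarrow> r = r'"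
    "\<And>l l' r. gtree E \<Longrightarrow> (l, r) \<in> E \<Longrightarrow> (l', r) \<in> E \<Longrightarrow> \<delta> r = Suc (\<mu> l) \<Longrightarrow> \<delta> r = Suc (\<mu> l') \<Longrightarrow> l = l'"
proof -
  obtain \<delta> \<mu> :: "_ \<Rightarrow> nat" where d: "\<delta> z = 0"
    "\<And>l r. (l, r) \<in> E \<Longrightarrow> \<delta> r = \<mu> l \<or> \<delta> r = Suc (\<mu> l)"
    "\<And>l. l \<in> Domain E \<Longrightarrow> \<exists>r. (l, r) \<in> E \<and> \<delta> r = \<mu> l"
    "\<And>r. r \<in> Range E \<Longrightarrow> r \<noteq> z \<Longrightarrow> \<exists>l. (l, r) \<in> E \<and> \<delta> r = Suc (\<mu> l)"
    using conn_distances[OF conn] by blast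
  \<comment> \<open>\<open>E1\<close> joins left vertices to their parents and \<open>E2\<close>
    right vertices to theirs; together they are all edges.\<close>
  define E1 where "E1 = {e \<in> E. \<delta> (snd e) = \<mu> (fst e)}"
  define E2 where "E2 = {e \<in> E. \<delta> (snd e) = Suc (\<mu> (fst e))}"
  have finE: "finite E1" "finite E2" using fin by (auto simp: E1_def E2_def)
  have "E = E1 \<union> E2" by (auto simp: E1_def E2_def dest: d(2))
  moreover have "E1 \<inter> E2 = {}" by (auto simp: E1_def E2_def)
  ultimately have E: "card E = card E1 + card E2"
    using finE card_Un_disjoint by metis
  have "fst ` E1 = Domain E"
    using d(3) by (fastforce simp: E1_def image_iff)
  then have E1: "card (Domain E) = card (fst ` E1)" by simp
  have R: "Range E = insert z (snd ` E2)"
    using d(4) conn(2) by (fastforce simp: E2_def image_iff)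
  have "z \<notin> snd ` E2" using d(1) by (auto simp: E2_def)
  then have E2: "card (Range E) = Suc (card (snd ` E2))" using R finE by simp
  have le: "card (fst ` E1) \<le> card E1" "card (snd ` E2) \<le> card E2"
    using finE by (auto intro: card_image_le)
  \<comment> \<open>For a tree both counts are tight, so no vertex has two parents.\<close>
  have "inj_on fst E1 \<and> inj_on snd E2" if "gtree E"
    using that E E1 E2 le finE unfolding gtree_def by (auto intro!: eq_card_imp_inj_on)
  then have inj: "inj_on fst E1" "inj_on snd E2" if "gtree E" using that by blast+
  show ?thesis
  proof (rule that[OF d])
    show "card (Domain E) + card (Range E) \<le> card E + 1" using E E1 E2 le by linarith
    show "r = r'" if "gtree E" "(l, r) \<in> E" "(l, r') \<in> E" "\<delta> r = \<mu> l" "\<delta> r' = \<mu> l" for l r r'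
      using inj_onD[OF inj(1)[OF that(1)], of "(l, r)" "(l, r')"] that by (simp add: E1_def)
    show "l = l'" if "gtree E" "(l, r) \<in> E" "(l', r) \<in> E" "\<delta> r = Suc (\<mu> l)" "\<delta> r = Suc (\<mu> l')" for l l' r
      using inj_onD[OF inj(2)[OF that(1)], of "(l, r)" "(l', r)"] that by (simp add: E2_def)
  qed
qed

lemma card_conn_ge:
  assumes "finite E" "conn UNIV E" "E \<noteq> {}"
  shows "card (Domain E) + card (Range E) \<le> card E + 1"
proof -
  obtain z where "z \<in> Range E" using assms(3) by fastforce
  from conn_parents[OF assms(1,2) this] show ?thesis by blast
qed

text \<open>All neighbours but one of the parent of a vertex at maximal distance from \<open>z\<close> are leaves.\<close>

lemma gtree_bunch:
  assumes fin: "finite E" and tree: "gtree E" and z: "z \<in> Range E" "Range E \<noteq> {z}"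
  obtains
    (left_leaves) y d where "y \<noteq> z" "(d, y) \<in> E" "\<exists>l. l \<noteq> d \<and> (l, y) \<in> E"
      "\<And>l r. (l, y) \<in> E \<Longrightarrow> l \<noteq> d \<Longrightarrow> (l, r) \<in> E \<Longrightarrow> r = y"
  | (right_leaves) x p where "(x, p) \<in> E" "\<exists>r. r \<noteq> p \<and> (x, r) \<in> E"
      "\<And>r. (x, r) \<in> E \<Longrightarrow> r \<noteq> p \<Longrightarrow> r \<noteq> z"
      "\<And>l r. (x, r) \<in> E \<Longrightarrow> r \<noteq> p \<Longrightarrow> (l, r) \<in> E \<Longrightarrow> l = x"
proof -
  obtain \<delta> \<mu> :: "_ \<Rightarrow> nat" where d: "\<delta> z = 0"
    "\<And>l r. (l, r) \<in> E \<Longrightarrow> \<delta> r = \<mu> l \<or> \<delta> r = Suc (\<mu> l)"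
    "\<And>l. l \<in> Domain E \<Longrightarrow> \<exists>r. (l, r) \<in> E \<and> \<delta> r = \<mu> l"
    "\<And>r. r \<in> Range E \<Longrightarrow> r \<noteq> z \<Longrightarrow> \<exists>l. (l, r) \<in> E \<and> \<delta> r = Suc (\<mu> l)"
    "\<And>l r r'. (l, r) \<in> E \<Longrightarrow> (l, r') \<in> E \<Longrightarrow> \<delta> r = \<mu> l \<Longrightarrow> \<delta> r' = \<mu> l \<Longrightarrow> r = r'"
    "\<And>l l' r. (l, r) \<in> E \<Longrightarrow> (l', r) \<in> E \<Longrightarrow> \<delta> r = Suc (\<mu> l) \<Longrightarrow> \<delta> r = Suc (\<mu> l') \<Longrightarrow> l = l'"
    using conn_parents[OF fin conjunct1[OF tree[unfolded gtree_def]] z(1)] tree by (smt (verit, best))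
  have finR: "finite (Range E)" using fin by (rule finite_Range)
  define m where "m = Max (\<delta> ` Range E)"
  have le: "\<delta> r \<le> m" if "r \<in> Range E" for r unfolding m_def using that finR by auto
  have "m \<in> \<delta> ` Range E" unfolding m_def using finR z(1) by (intro Max_in) auto
  then obtain y where y: "y \<in> Range E" "\<delta> y = m" by blast
  obtain r0 where r0: "r0 \<in> Range E" "r0 \<noteq> z" using z by blast
  have "m > 0" using d(4)[OF r0] le[OF r0(1)] by auto
  have nz: "r \<noteq> z" if "\<delta> r = m" for r using that \<open>m > 0\<close> d(1) by auto
  show ?thesis
  \<comment> \<open>If a deepest right vertex has several neighbours, all but its parent are leaves,
    since their further children would be deeper. Otherwise all deepest right vertices are leaves,
    and the parent of one of them is the centre of the bunch.\<close>
  proof (cases "\<exists>y\<in>Range E. \<delta> y = m \<and> (\<exists>l l'. (l, y) \<in> E \<and> (l', y) \<in> E \<and> l \<noteq> l')")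
    case True
    then obtain y l l' where y: "y \<in> Range E" "\<delta> y = m" and l: "(l, y) \<in> E" "(l', y) \<in> E" "l \<noteq> l'" by blast
    obtain d' where d': "(d', y) \<in> E" "\<delta> y = Suc (\<mu> d')" using d(4) y nz by blast
    show ?thesis
    proof (rule left_leaves[of y d'])
      show "y \<noteq> z" using nz y by blast
      show "(d', y) \<in> E" by fact
      show "\<exists>l. l \<noteq> d' \<and> (l, y) \<in> E" using l by metis
      fix l r assume l: "(l, y) \<in> E" "l \<noteq> d'" "(l, r) \<in> E"
      then have "\<delta> y = \<mu> l" using d(2,6) d' by metis
      moreover have "\<delta> r \<le> m" using le l by blast
      ultimately have "\<delta> r = \<mu> l" using d(2)[OF l(3)] y by auto
      then show "r = y" using d(5) l \<open>\<delta> y = \<mu> l\<close> by metis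
    qed
  next
    case False
    obtain x where x: "(x, y) \<in> E" "\<delta> y = Suc (\<mu> x)" using d(4) y nz by blast
    obtain p where p: "(x, p) \<in> E" "\<delta> p = \<mu> x" using d(3) x by blast
    have m: "\<delta> r = m" if "(x, r) \<in> E" "r \<noteq> p" for r
      using that d(2,5) p x y by metis
    show ?thesis
    proof (rule right_leaves[of x p])
      show "\<exists>r. r \<noteq> p \<and> (x, r) \<in> E" using x p by (intro exI[of _ y]) auto
      show "l = x" if "(x, r) \<in> E" "r \<noteq> p" "(l, r) \<in> E" for l r
        using False m[OF that(1,2)] that by blast
    qed (use p nz m in blast)+
  qed
qed

section \<open>Collapsing a connected set of right vertices to one vertex\<close>

definition collapse :: "'b set \<Rightarrow> 'b \<Rightarrow> 'b option" where
  "collapse Z r = (if r \<in> Z then None else Some r)"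

lemma collapse_eq_Some [simp]: "collapse Z r = Some s \<longleftrightarrow> r = s \<and> r \<notin> Z"
  and collapse_eq_None [simp]: "collapse Z r = None \<longleftrightarrow> r \<in> Z"
  by (auto simp: collapse_def)

text \<open>If \<open>Z\<close> meets the range, the part at \<open>Z\<close> is connected and has
  at least \<open>card (Domain EZ) + card (Range EZ) - 1\<close> edges by
  \<open>card_conn_ge\<close>. At most \<open>card (Domain EZ)\<close> edges replace them, so the
  number of edges drops at least as much as that of the right vertices.\<close>

lemma gtree_collapse:
  assumes fin: "finite E" and tree: "gtree E" and Z: "conn Z E"
  shows "gtree (map_prod id (collapse Z) ` E)"
proof -
  let ?G = "map_prod id (collapse Z) ` E"
  have G: "(l, q) \<in> ?G \<longleftrightarrow> (\<exists>r. (l, r) \<in> E \<and> q = collapse Z r)" for l q by force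
  have "conn UNIV ?G" unfolding conn_def
  proof (intro ballI)
    fix q q' assume "q \<in> UNIV \<inter> Range ?G" "q' \<in> UNIV \<inter> Range ?G"
    then obtain r r' where r: "r \<in> Range E" "q = collapse Z r" "r' \<in> Range E" "q' = collapse Z r'"
      unfolding Range_iff G by blast
    have "(r, r') \<in> (adj UNIV E)\<^sup>*"
      using tree r by (intro connD) (auto simp: gtree_def)
    then have "(collapse Z r, collapse Z r') \<in> (adj UNIV ?G)\<^sup>*"
    proof (induction rule: rtrancl_induct)
      case (step s t)
      then have "(collapse Z s, collapse Z t) \<in> adj UNIV ?G"
        unfolding adj_def mem_Collect_eq prod.case G by blast
      with step.IH show ?case by (rule rtrancl_into_rtrancl)
    qed simp
    then show "(q, q') \<in> (adj UNIV ?G)\<^sup>*" using r by simp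
  qed
  moreover have "card ?G + 1 \<le> card (Domain ?G) + card (Range ?G)"
  proof (cases "Range E \<inter> Z = {}")
    case True
    have RG: "Range ?G = Some ` Range E"
    proof (intro set_eqI)
      fix q
      have "q \<in> Range ?G \<longleftrightarrow> (\<exists>r \<in> Range E. q = collapse Z r)" unfolding Range_iff G by blast
      moreover have "collapse Z r = Some r" if "r \<in> Range E" for r using that True by auto
      ultimately show "q \<in> Range ?G \<longleftrightarrow> q \<in> Some ` Range E" by (metis image_iff)
    qed
    have DG: "Domain ?G = Domain E" unfolding set_eq_iff Domain_iff G by blast
    have "card ?G \<le> card E" using fin by (rule card_image_le)
    moreover have "card (Range ?G) = card (Range E)" unfolding RG by (simp add: card_image)
    ultimately show ?thesis using tree DG unfolding gtree_def by simp
  next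
    case False
    define EZ where "EZ = {e \<in> E. snd e \<in> Z}"
    have "conn UNIV EZ" unfolding conn_def
    proof (intro ballI)
      fix r r' assume "r \<in> UNIV \<inter> Range EZ" "r' \<in> UNIV \<inter> Range EZ"
      then have "(r, r') \<in> (adj Z E)\<^sup>*" using Z by (intro connD) (auto simp: EZ_def)
      moreover have "adj Z E \<subseteq> adj UNIV EZ" by (auto simp: adj_def EZ_def)
      ultimately show "(r, r') \<in> (adj UNIV EZ)\<^sup>*" using rtrancl_mono by blast
    qed
    moreover have finZ: "finite EZ" using fin by (simp add: EZ_def)
    moreover have "EZ \<noteq> {}" using False by (auto simp: EZ_def)
    ultimately have 1: "card (Domain EZ) + card (Range EZ) \<le> card EZ + 1" by (intro card_conn_ge)
    have "?G \<subseteq> map_prod id (collapse Z) ` (E - EZ) \<union> Domain EZ \<times> {None}"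
    proof
      fix g assume "g \<in> ?G"
      then obtain e where e: "g = map_prod id (collapse Z) e" "e \<in> E" by (rule imageE)
      show "g \<in> map_prod id (collapse Z) ` (E - EZ) \<union> Domain EZ \<times> {None}"
      proof (cases "e \<in> EZ")
        case True
        then have "g = (fst e, None)" "fst e \<in> Domain EZ"
          using e by (simp_all add: EZ_def prod_eq_iff Domain_fst)
        then show ?thesis by simp
      qed (use e in simp)
    qed
    then have "card ?G \<le> card (map_prod id (collapse Z) ` (E - EZ) \<union> Domain EZ \<times> {None})"
      using fin finZ by (intro card_mono) (auto simp: finite_Domain)
    also have "\<dots> \<le> card (map_prod id (collapse Z) ` (E - EZ)) + card (Domain EZ \<times> {None :: 'b option})"
      by (rule card_Un_le)
    also have "card (map_prod id (collapse Z) ` (E - EZ)) \<le> card (E - EZ)"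
      using fin by (intro card_image_le) simp
    finally have 2: "card ?G \<le> card (E - EZ) + card (Domain EZ)" by (simp add: card_cartesian_product)
    have 3: "card E = card EZ + card (E - EZ)"
      using fin finZ by (metis (no_types, lifting) EZ_def card_Diff_subset card_mono le_add_diff_inverse mem_Collect_eq subsetI)
    have "Range ?G = insert None (Some ` (Range E - Z))"
    proof (intro set_eqI)
      fix q
      have "q \<in> Range ?G \<longleftrightarrow> (\<exists>r \<in> Range E. q = collapse Z r)" unfolding Range_iff G by blast
      then show "q \<in> Range ?G \<longleftrightarrow> q \<in> insert None (Some ` (Range E - Z))"
        using False by (auto simp: collapse_def)
    qed
    then have 4: "card (Range ?G) = Suc (card (Range E - Z))"
      using fin by (simp add: card_image finite_Range)
    have "Range EZ = Range E \<inter> Z" by (auto simp: EZ_def)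
    then have 5: "card (Range E) = card (Range E - Z) + card (Range EZ)"
      using fin finite_Range by (metis Int_commute add.commute card_Int_Diff)
    have "Domain ?G = Domain E" unfolding set_eq_iff Domain_iff G by blast
    then have "card (Domain ?G) = card (Domain E)" by simp
    then show ?thesis using 1 2 3 4 5 tree unfolding gtree_def by linarith
  qed
  ultimately show ?thesis unfolding gtree_def by blast
qed

subsection \<open>Extension graphs of tree sets\<close>

text \<open>The first vertex of a longest path is a leaf: a second edge at it would prolong the path
  or close a cycle.\<close>

lemma acyclic_has_leaf:
  assumes fin: "finite E" and ne: "E \<noteq> {}" and E: "\<And>e. e \<in> E \<Longrightarrow> \<exists>u v. u \<noteq> v \<and> e = {u, v}"
    and acyc: "\<nexists>p. ugraph_cycle E p"
  shows "\<exists>e v. e \<in> E \<and> v \<in> e \<and> (\<forall>e' \<in> E. v \<in> e' \<longrightarrow> e' = e)"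
proof -
  define P where "P p \<longleftrightarrow> distinct p \<and> 2 \<le> length p \<and> set p \<subseteq> \<Union>E \<and>
    (\<forall>i. Suc i < length p \<longrightarrow> {p ! i, p ! Suc i} \<in> E)" for p
  have "finite (\<Union>E)" using fin E by fastforce
  then have bound: "length p \<le> card (\<Union>E)" if "P p" for p
    using that card_mono[of "\<Union>E" "set p"] distinct_card[of p] unfolding P_def by simp
  obtain e u v where "e \<in> E" "u \<noteq> v" "e = {u, v}" using ne E by blast
  then have "P [u, v]" unfolding P_def by (auto simp: nth_Cons split: nat.splits)
  then obtain p where p: "P p" and max: "\<And>q. P q \<Longrightarrow> length q \<le> length p"
    using Lattices_Big.ex_has_greatest_nat[of P "[u, v]" length "Suc (card (\<Union>E))"] bound
    by (auto simp: less_Suc_eq_le)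
  then obtain v w q where q: "p = v # w # q" unfolding P_def by (cases p; cases "tl p") auto
  have "{v, w} \<in> E" using p unfolding P_def q by force
  moreover have "e' = {v, w}" if e': "e' \<in> E" "v \<in> e'" for e'
  proof -
    obtain u where u: "e' = {v, u}" "u \<noteq> v" using E e' by blast
    show ?thesis
    proof (rule ccontr)
      assume "e' \<noteq> {v, w}"
      then have uw: "u \<noteq> w" using u by blast
      show False
      proof (cases "u \<in> set p")
        case False
        have "P (u # p)" unfolding P_def
        proof (intro conjI allI impI)
          show "{(u # p) ! i, (u # p) ! Suc i} \<in> E" if "Suc i < length (u # p)" for i
            using that p e' u q unfolding P_def by (cases i) (auto simp: insert_commute)
        qed (use p False u e' in \<open>auto simp: P_def\<close>)
        then show False using max by fastforce
      next
        case True
        then obtain k where k: "k < length p" "p ! k = u" by (metis in_set_conv_nth)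
        have "k \<noteq> 0" "k \<noteq> 1" using k(2) u(2) uw q by (metis nth_Cons_0, metis One_nat_def nth_Cons_0 nth_Cons_Suc)
        then have k2: "2 \<le> k" by linarith
        have "ugraph_cycle E (take (Suc k) p)" unfolding ugraph_cycle_def
        proof (intro conjI allI impI)
          fix i assume "i < length (take (Suc k) p)"
          then have i: "i \<le> k" using k by simp
          show "{take (Suc k) p ! i, take (Suc k) p ! (Suc i mod length (take (Suc k) p))} \<in> E"
          proof (cases "i = k")
            case True
            moreover have "p ! 0 = v" using q by simp
            ultimately show ?thesis using k e' u by (simp add: insert_commute min_absorb2)
          next
            case False
            then show ?thesis using i k p by (simp add: P_def min_absorb2)
          qed
        qed (use k k2 p in \<open>auto simp: P_def\<close>)
        then show False using acyc by blast
      qed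
    qed
  qed
  ultimately show ?thesis by blast
qed

text \<open>Induction on the number of edges: deleting the only edge at a leaf \<open>v\<close> also
  removes \<open>v\<close>.\<close>

lemma acyclic_card_edges:
  assumes "finite E" "E \<noteq> {}" "\<And>e. e \<in> E \<Longrightarrow> \<exists>u v. u \<noteq> v \<and> e = {u, v}" "\<nexists>p. ugraph_cycle E p"
  shows "card E + 1 \<le> card (\<Union>E)"
  using assms
proof (induction "card E" arbitrary: E)
  case 0
  then show ?case by simp
next
  case (Suc n)
  obtain e v where e: "e \<in> E" "v \<in> e" "\<And>e'. e' \<in> E \<Longrightarrow> v \<in> e' \<Longrightarrow> e' = e"
    using acyclic_has_leaf[OF Suc.prems] by metis
  have finU: "finite (\<Union>E)" using Suc.prems by fastforce
  show ?case
  proof (cases "E - {e} = {}")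
    case True
    then have "E = {e}" using e by blast
    moreover have "card e = 2" using Suc.prems(3)[OF e(1)] by auto
    ultimately show ?thesis by simp
  next
    case False
    have sub: "\<Union>(E - {e}) \<subseteq> \<Union>E - {v}" using e by blast
    have "\<nexists>p. ugraph_cycle (E - {e}) p" using Suc.prems(4) unfolding ugraph_cycle_def by blast
    moreover have "n = card (E - {e})" using Suc.hyps(2) Suc.prems(1) e(1) by simp
    ultimately have "card (E - {e}) + 1 \<le> card (\<Union>(E - {e}))"
      using Suc.prems(1,3) False by (intro Suc.hyps(1)) simp_all
    also have "\<dots> \<le> card (\<Union>E - {v})" using sub finU by (simp add: card_mono)
    finally have "card (E - {e}) + 1 \<le> card (\<Union>E - {v})" .
    moreover have "card E = Suc (card (E - {e}))" using Suc.prems(1) e(1) by (rule card.remove)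
    moreover have "card (\<Union>E) = Suc (card (\<Union>E - {v}))" by (rule card.remove[OF finU]) (use e in blast)
    ultimately show ?thesis by linarith
  qed
qed

section \<open>Extensions of words in factorial biextendable sets\<close>

lemma factorialD: "factorial T \<Longrightarrow> u @ v @ w \<in> T \<Longrightarrow> v \<in> T"
  unfolding factorial_def sublist_def by blast

lemma factorial_prefix: "factorial T \<Longrightarrow> v @ w \<in> T \<Longrightarrow> v \<in> T"
  using factorialD[of T "[]" v w] by simp

lemma factorial_suffix: "factorial T \<Longrightarrow> u @ v \<in> T \<Longrightarrow> v \<in> T"
  using factorialD[of T u v "[]"] by simp

lemma factorial_tl: "factorial T \<Longrightarrow> c # v \<in> T \<Longrightarrow> v \<in> T"
  using factorial_suffix[of T "[c]" v] by simp

lemma biextendableD: "biextendable T \<Longrightarrow> w \<in> T \<Longrightarrow> \<exists>a b. a # w @ [b] \<in> T"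
  unfolding biextendable_def by simp

lemma left_extend: "factorial T \<Longrightarrow> biextendable T \<Longrightarrow> w \<in> T \<Longrightarrow> \<exists>a. a # w \<in> T"
  using biextendableD factorial_prefix by (metis append_Cons)

lemma right_extend: "factorial T \<Longrightarrow> biextendable T \<Longrightarrow> w \<in> T \<Longrightarrow> \<exists>b. w @ [b] \<in> T"
  using biextendableD factorial_tl by metis

lemma mem_two_sided_ext [simp]: "(a, b) \<in> two_sided_ext T w \<longleftrightarrow> a # w @ [b] \<in> T"
  unfolding two_sided_ext_def by simp

lemma Domain_two_sided_ext:
  assumes "factorial T" "biextendable T"
  shows "a \<in> Domain (two_sided_ext T w) \<longleftrightarrow> a # w \<in> T"
  unfolding Domain_iff mem_two_sided_ext
  using right_extend[OF assms, of "a # w"] factorial_prefix[OF assms(1), of "a # w"] by auto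

lemma Range_two_sided_ext:
  assumes "factorial T" "biextendable T"
  shows "b \<in> Range (two_sided_ext T w) \<longleftrightarrow> w @ [b] \<in> T"
  unfolding Range_iff mem_two_sided_ext
  using left_extend[OF assms, of "w @ [b]"] factorial_tl[OF assms(1)] by blast

lemma tree_set_gtree:
  fixes T :: "'a::finite list set"
  assumes "tree_set T" "w \<in> T"
  shows "gtree (two_sided_ext T w)"
proof -
  let ?E = "two_sided_ext T w" and ?G = "ext_graph_edges T w"
  have fb: "factorial T" "biextendable T" and tree: "ugraph_tree (ext_graph_verts T w) ?G"
    using assms unfolding tree_set_def by auto
  have verts: "Inr r \<in> ext_graph_verts T w" if "r \<in> Range ?E" for r
    using that Range_two_sided_ext[OF fb] by (auto simp: ext_graph_verts_def right_ext_def)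
  have edges: "?G = (\<lambda>(a, b). {Inl a, Inr b}) ` ?E" unfolding ext_graph_edges_def image_def Bex_def
    by (simp add: split_paired_Ex conj_commute)
  have "conn UNIV ?E" unfolding conn_def
  proof (intro ballI)
    fix r r' assume r: "r \<in> UNIV \<inter> Range ?E" "r' \<in> UNIV \<inter> Range ?E"
    then have "(Inr r, Inr r') \<in> {(x, y). {x, y} \<in> ?G}\<^sup>*"
      using tree verts unfolding ugraph_tree_def ugraph_connected_def by blast
    \<comment> \<open>Invariant along a path that alternates between the two sides: a right vertex
      is reachable by \<open>adj\<close> steps, and a left vertex has a neighbour that is.\<close>
    moreover define Q where "Q v = (case v of Inr s \<Rightarrow> (r, s) \<in> (adj UNIV ?E)\<^sup>*
      | Inl l \<Rightarrow> \<exists>s. (l, s) \<in> ?E \<and> (r, s) \<in> (adj UNIV ?E)\<^sup>*)" for v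
    ultimately have "Q (Inr r')"
    proof (induction rule: rtrancl_induct)
      case base
      then show ?case by (simp add: Q_def)
    next
      case (step v v')
      from step(2) obtain a b where ab: "(a, b) \<in> ?E" "{v, v'} = {Inl a, Inr b}" unfolding edges by auto
      then consider "v = Inl a" "v' = Inr b" | "v = Inr b" "v' = Inl a" by (auto simp: doubleton_eq_iff)
      then show ?case
      proof cases
        case 1
        then obtain s where "(a, s) \<in> ?E" "(r, s) \<in> (adj UNIV ?E)\<^sup>*" using step(3) by (auto simp: Q_def)
        moreover from this ab have "(s, b) \<in> adj UNIV ?E" unfolding adj_def by blast
        ultimately show ?thesis using 1 by (simp add: Q_def)
      next
        case 2
        then show ?thesis using step(3) ab by (auto simp: Q_def)
      qed
    qed
    then show "(r, r') \<in> (adj UNIV ?E)\<^sup>*" by (simp add: Q_def)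
  qed
  moreover have "card ?E + 1 \<le> card (Domain ?E) + card (Range ?E)"
  proof -
    have inj: "inj_on (\<lambda>(a, b). {Inl a, Inr b}) ?E" by (auto simp: inj_on_def doubleton_eq_iff)
    have "?E \<noteq> {}" using biextendableD[OF fb(2) assms(2)] by (metis empty_iff mem_two_sided_ext)
    then have "card ?G + 1 \<le> card (\<Union>?G)"
      using tree edges by (intro acyclic_card_edges) (auto simp: ugraph_tree_def)
    moreover have "\<Union>?G = Inl ` Domain ?E \<union> Inr ` Range ?E" unfolding edges by (auto simp: image_iff Domain_iff Range_iff)
    moreover have "card (Inl ` Domain ?E \<union> Inr ` Range ?E) =
        card (Inl ` Domain ?E :: ('a + 'a) set) + card (Inr ` Range ?E :: ('a + 'a) set)"
      by (rule card_Un_disjoint) auto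
    ultimately show ?thesis using inj by (simp add: edges card_image)
  qed
  ultimately show ?thesis unfolding gtree_def by blast
qed

subsection \<open>Elementary desubstitution\<close>

text \<open>The invariant of the construction, kept by moves and by reversal. Dendric is another
  name for tree sets.\<close>

definition recurrent_dendric :: "'a list set \<Rightarrow> bool" where
  "recurrent_dendric T \<longleftrightarrow> factorial T \<and> biextendable T \<and> (\<forall>w\<in>T. gtree (two_sided_ext T w)) \<and>
     (\<forall>a. [a] \<in> T) \<and> (\<forall>u\<in>T. \<exists>n. \<forall>w\<in>T. length w = n \<longrightarrow> sublist u w)"

text \<open>The letter \<open>c \<noteq> x\<close> in front ensures that the cut does not fall inside an occurrence of \<open>x y\<close>.\<close>

definition desub :: "'a \<Rightarrow> 'a \<Rightarrow> 'a list set \<Rightarrow> 'a list set" where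
  "desub x y T = {w. \<exists>c. c \<noteq> x \<and> c # elem_alpha x y w \<in> T}"

text \<open>
  The sets of left extensions of the words \<open>y # u\<close>, \<open>u\<close> of a fixed length, are the edges of a
  hypertree, which is refined as the length grows. A letter is removable if it lies on at most one
  edge with at least two elements at every stage, that is, if it is never a cut vertex.
\<close>

definition removable :: "'a list set \<Rightarrow> 'a \<Rightarrow> 'a \<Rightarrow> bool" where
  "removable T x y \<longleftrightarrow> (\<forall>u v. length u = length v \<longrightarrow> x # y # u \<in> T \<longrightarrow> x # y # v \<in> T \<longrightarrow>
     (\<exists>c. c \<noteq> x \<and> c # y # u \<in> T) \<longrightarrow> (\<exists>c. c \<noteq> x \<and> c # y # v \<in> T) \<longrightarrow> u = v)"

lemma word_morphism_Nil [simp]: "word_morphism h [] = []"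
  and word_morphism_Cons [simp]: "word_morphism h (c # w) = h c @ word_morphism h w"
  and word_morphism_append [simp]: "word_morphism h (v @ w) = word_morphism h v @ word_morphism h w"
  by (simp_all add: word_morphism_def)

lemma elem_alpha_Nil [simp]: "elem_alpha x y [] = []"
  and elem_alpha_Cons [simp]: "elem_alpha x y (c # w) = (if c = x then [x, y] else [c]) @ elem_alpha x y w"
  and elem_alpha_append [simp]: "elem_alpha x y (v @ w) = elem_alpha x y v @ elem_alpha x y w"
  by (simp_all add: elem_alpha_def)

lemma elem_alpha_last: "x \<noteq> y \<Longrightarrow> c \<noteq> x \<Longrightarrow> last (c # elem_alpha x y w) \<noteq> x"
  by (induction w arbitrary: c) (auto split: if_splits)

lemma elem_alpha_length: "length w \<le> length (elem_alpha x y w)"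
  by (induction w) auto

text \<open>In an image the letter \<open>x\<close> occurs only as the start of a block
  \<open>x y\<close>, so a cut that does not come right after \<open>x\<close> separates the images
  of two letters.\<close>

lemma elem_alpha_split:
  assumes "x \<noteq> y" "elem_alpha x y w = p @ q" "p = [] \<or> last p \<noteq> x"
  shows "\<exists>u v. w = u @ v \<and> elem_alpha x y u = p \<and> elem_alpha x y v = q"
  using assms(2,3)
proof (induction w arbitrary: p)
  case Nil
  then show ?case by simp
next
  case (Cons c w)
  show ?case
  proof (cases p)
    case Nil
    then show ?thesis using Cons.prems by (intro exI[of _ "[]"] exI[of _ "c # w"]) simp
  next
    case p: (Cons d p')
    define p'' where "p'' = (if c = x then tl p' else p')"
    have "p = (if c = x then [x, y] else [c]) @ p''"
    proof (cases "c = x")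
      case True
      then have "p' \<noteq> []" using p Cons.prems by auto
      then show ?thesis using True p Cons.prems(1) by (cases p') (auto simp: p''_def)
    qed (use p Cons.prems(1) in \<open>auto simp: p''_def\<close>)
    moreover from this have "elem_alpha x y w = p'' @ q" using Cons.prems(1) by (simp split: if_splits)
    moreover from calculation have "p'' = [] \<or> last p'' \<noteq> x" using Cons.prems(2) by (auto split: if_splits)
    ultimately obtain u v where "w = u @ v" "elem_alpha x y u = p''" "elem_alpha x y v = q"
      using Cons.IH by blast
    then show ?thesis using \<open>p = _ @ p''\<close> by (intro exI[of _ "c # u"] exI[of _ v]) simp
  qed
qed

lemma elem_alpha_inj: "x \<noteq> y \<Longrightarrow> elem_alpha x y w = elem_alpha x y w' \<Longrightarrow> w = w'"
proof (induction w arbitrary: w')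
  case Nil
  then show ?case by (cases w') (auto split: if_splits)
next
  case (Cons c w)
  then show ?case by (cases w') (auto split: if_splits)
qed

lemma conn_two_sided_ext:
  "factorial T \<Longrightarrow> \<forall>w\<in>T. conn S (two_sided_ext T w) \<Longrightarrow> conn S (two_sided_ext T w)"
proof (cases "w \<in> T")
  case False
  moreover assume "factorial T"
  ultimately have "two_sided_ext T w = {}" using factorialD[of T "[_]" w "[_]"] by auto
  then show ?thesis by (simp add: conn_def)
qed simp

section \<open>Desubstitution of a set in which \<open>x\<close> is always followed by
  \<open>y\<close>\<close>

locale desubstitution =
  fixes T :: "'a list set" and x y :: 'a
  assumes fact: "factorial T" and bi: "biextendable T" and neq: "x \<noteq> y"
    and follow: "\<And>c. [x, c] \<in> T \<Longrightarrow> c = y"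
begin

lemma follow': "u @ x # c # v \<in> T \<Longrightarrow> c = y"
  using follow factorialD[OF fact, of u "[x, c]" v] by simp

lemma follow'': "x # c # v \<in> T \<Longrightarrow> c = y"
  using follow'[of "[]"] by simp

lemma not_x: "c # d # v \<in> T \<Longrightarrow> d \<noteq> y \<Longrightarrow> c \<noteq> x"
  using follow'' by blast

lemma desub_image: "w \<in> desub x y T \<Longrightarrow> elem_alpha x y w \<in> T"
  unfolding desub_def using factorial_tl[OF fact] by blast

lemma factorial_desub: "factorial (desub x y T)"
  unfolding factorial_def
proof (intro ballI allI impI)
  fix w u assume "w \<in> desub x y T" "sublist u w"
  then obtain c p s where c: "c \<noteq> x" "c # elem_alpha x y (p @ u @ s) \<in> T"
    unfolding desub_def sublist_def by blast
  let ?q = "c # elem_alpha x y p"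
  have "butlast ?q @ (last ?q # elem_alpha x y u) @ elem_alpha x y s \<in> T"
    using c(2) append_butlast_last_id[of ?q] by (metis append.assoc append_Cons append_Nil elem_alpha_append list.distinct(1))
  then have "last ?q # elem_alpha x y u \<in> T" by (rule factorialD[OF fact])
  then show "u \<in> desub x y T" using elem_alpha_last[OF neq c(1)] unfolding desub_def by blast
qed

lemma elem_alpha_snoc: "u @ elem_alpha x y [r] \<in> T \<longleftrightarrow> u @ [r] \<in> T"
proof (cases "r = x")
  case True
  show ?thesis
  proof
    assume "u @ [r] \<in> T"
    then obtain b where b: "(u @ [r]) @ [b] \<in> T" using right_extend[OF fact bi] by blast
    then have "b = y" using follow'[of u b "[]"] True by simp
    then show "u @ elem_alpha x y [r] \<in> T" using b True by simp
  qed (use True factorial_prefix[OF fact, of "u @ [x]" "[y]"] in simp)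
qed simp

text \<open>A letter \<open>y\<close> in front of the image of \<open>w\<close> is a block of its
  own or the end of a block \<open>x y\<close>; the extension graph of
  \<open>y # elem_alpha x y w\<close> tells which. An \<open>x\<close> directly in front would be
  cut off from its \<open>y\<close>, so the old vertex \<open>x\<close> is discarded.\<close>

lemma two_sided_ext_desub:
  "two_sided_ext (desub x y T) w =
     split_vertex x y (two_sided_ext T (elem_alpha x y w)) (two_sided_ext T (y # elem_alpha x y w))"
proof (intro set_eqI, clarify)
  fix l r
  let ?W = "elem_alpha x y w"
  have "(l, r) \<in> two_sided_ext (desub x y T) w \<longleftrightarrow>
      (\<exists>c. c \<noteq> x \<and> (c # elem_alpha x y [l] @ ?W) @ elem_alpha x y [r] \<in> T)"
    by (simp add: desub_def)
  also have "\<dots> \<longleftrightarrow> (\<exists>c. c \<noteq> x \<and> c # elem_alpha x y [l] @ ?W @ [r] \<in> T)"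
    unfolding elem_alpha_snoc by simp
  also have "\<dots> \<longleftrightarrow> (l \<noteq> x \<and> l \<noteq> y \<and> l # ?W @ [r] \<in> T) \<or> (l = x \<and> x # y # ?W @ [r] \<in> T) \<or>
      (l = y \<and> (\<exists>c. c \<noteq> x \<and> c # y # ?W @ [r] \<in> T))"
  proof (cases "l = y")
    case False
    \<comment> \<open>For \<open>l \<noteq> y\<close> the image of \<open>l\<close> starts with a
      letter other than \<open>y\<close>, so it is never preceded by \<open>x\<close>.\<close>
    have "(\<exists>c. c \<noteq> x \<and> c # elem_alpha x y [l] @ ?W @ [r] \<in> T) \<longleftrightarrow> elem_alpha x y [l] @ ?W @ [r] \<in> T"
      (is "_ \<longleftrightarrow> ?v \<in> T")
    proof
      assume "?v \<in> T"
      then obtain c where "c # ?v \<in> T" using left_extend[OF fact bi] by blast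
      moreover from this have "c \<noteq> x" using False neq not_x[of c l] not_x[of c x] by (auto split: if_splits)
      ultimately show "\<exists>c. c \<noteq> x \<and> c # ?v \<in> T" by blast
    qed (use factorial_tl[OF fact] in blast)
    then show ?thesis using False by auto
  qed (use neq in simp)
  also have "\<dots> \<longleftrightarrow> (l, r) \<in> split_vertex x y (two_sided_ext T ?W) (two_sided_ext T (y # ?W))"
    unfolding split_vertex_def by auto
  finally show "(l, r) \<in> two_sided_ext (desub x y T) w \<longleftrightarrow>
    (l, r) \<in> split_vertex x y (two_sided_ext T ?W) (two_sided_ext T (y # ?W))" .
qed

lemma biextendable_desub: "biextendable (desub x y T)"
  unfolding biextendable_def
proof
  fix w assume "w \<in> desub x y T"
  then obtain c where c: "c \<noteq> x" "c # elem_alpha x y w \<in> T" unfolding desub_def by blast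
  then obtain e r where e: "e # (c # elem_alpha x y w) @ [r] \<in> T" using biextendableD[OF bi] by blast
  \<comment> \<open>If the letter in front of the image is the \<open>y\<close> of a block
    \<open>x y\<close>, the left extension is \<open>x\<close>.\<close>
  have "(if c = y \<and> e = x then x else c, r) \<in> two_sided_ext (desub x y T) w"
    unfolding two_sided_ext_desub split_vertex_def using e c(1) factorial_tl[OF fact e] by auto
  then show "\<exists>a b. [a] @ w @ [b] \<in> desub x y T" by auto
qed

lemma decode: "v \<in> T \<Longrightarrow> v = [] \<or> last v \<noteq> x \<Longrightarrow> \<exists>w. v = elem_alpha x y w"
proof (induction v rule: induct_list012)
  case 1
  show ?case by (intro exI[of _ "[]"]) simp
next
  case (2 d)
  then show ?case by (intro exI[of _ "[d]"]) simp
next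
  case (3 d e v)
  show ?case
  proof (cases "d = x")
    case True
    have "e = y" using 3(3) follow'' True by blast
    moreover have "v \<in> T" using 3(3) factorial_tl[OF fact] by blast
    moreover have "v = [] \<or> last v \<noteq> x" using 3(4) by auto
    ultimately obtain w where "v = elem_alpha x y w" using 3(1) by blast
    then show ?thesis using True \<open>e = y\<close> by (intro exI[of _ "x # w"]) simp
  next
    case False
    have "e # v \<in> T" using 3(3) factorial_tl[OF fact] by blast
    moreover have "last (e # v) \<noteq> x" using 3(4) by auto
    ultimately obtain w where "e # v = elem_alpha x y w" using 3(2) by blast
    then show ?thesis using False by (intro exI[of _ "d # w"]) simp
  qed
qed

text \<open>A word of \<open>T\<close> is prolonged until it comes after a letter other than
  \<open>x\<close> and does not end with \<open>x\<close>; then \<open>decode\<close>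
  applies.\<close>

lemma Fac_desub: "T = Fac (elem_alpha x y ` desub x y T)"
proof
  show "Fac (elem_alpha x y ` desub x y T) \<subseteq> T"
    using desub_image fact unfolding Fac_def factorial_def by blast
  show "T \<subseteq> Fac (elem_alpha x y ` desub x y T)"
  proof
    fix u assume u: "u \<in> T"
    \<comment> \<open>Two letters on the left suffice: an \<open>x\<close> is never preceded by
      \<open>x\<close>, since \<open>x\<close> is followed by \<open>y\<close>.\<close>
    obtain e p where e: "e \<noteq> x" "e # p @ u \<in> T"
    proof -
      obtain c where c: "c # u \<in> T" using left_extend[OF fact bi u] by blast
      obtain d where d: "d # c # u \<in> T" using left_extend[OF fact bi c] by blast
      show ?thesis
      proof (cases "c = x")
        case True
        then show ?thesis using that[of d "[x]"] d not_x neq by auto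
      qed (use that[of c "[]"] c in simp)
    qed
    obtain v where v: "e # p @ u @ v \<in> T" "p @ u @ v = [] \<or> last (p @ u @ v) \<noteq> x"
    proof (cases "p @ u = [] \<or> last (p @ u) \<noteq> x")
      case True
      then show ?thesis using that[of "[]"] e by simp
    next
      case False
      then obtain q where q: "p @ u = q @ [x]" by (metis append_butlast_last_id)
      obtain b where b: "(e # p @ u) @ [b] \<in> T" using right_extend[OF fact bi e(2)] by blast
      then have "b = y" using q follow'[of "e # q" b "[]"]
        by (metis append.assoc append_Cons append_Nil)
      then show ?thesis using that[of "[y]"] b neq by simp
    qed
    then obtain w where w: "p @ u @ v = elem_alpha x y w"
      using decode factorial_tl[OF fact] by blast
    then have "w \<in> desub x y T" using e v unfolding desub_def by auto
    moreover have "sublist u (elem_alpha x y w)" unfolding w[symmetric] by simp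
    ultimately show "u \<in> Fac (elem_alpha x y ` desub x y T)" unfolding Fac_def by blast
  qed
qed

text \<open>Images are not shorter than the words, so a long image contains
  \<open>c # elem_alpha x y u\<close> with \<open>c \<noteq> x\<close>. Both ends of the image of
  \<open>u\<close> are then borders of blocks, and the occurrence decodes to
  \<open>u\<close>.\<close>

lemma recurrent_desub:
  assumes rec: "\<forall>u\<in>T. \<exists>n. \<forall>w\<in>T. length w = n \<longrightarrow> sublist u w" and u: "u \<in> desub x y T"
  shows "\<exists>n. \<forall>w\<in>desub x y T. length w = n \<longrightarrow> sublist u w"
proof -
  obtain c where c: "c \<noteq> x" "c # elem_alpha x y u \<in> T" using u unfolding desub_def by blast
  then obtain n where n: "\<And>w. w \<in> T \<Longrightarrow> length w = n \<Longrightarrow> sublist (c # elem_alpha x y u) w"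
    using rec by blast
  have "sublist u w" if w: "w \<in> desub x y T" "length w = n" for w
  proof -
    let ?W = "elem_alpha x y w"
    have "take n ?W @ drop n ?W \<in> T" using desub_image w by simp
    then have "take n ?W \<in> T" by (rule factorial_prefix[OF fact])
    moreover have "length (take n ?W) = n" using elem_alpha_length[of w x y] w by simp
    ultimately have "sublist (c # elem_alpha x y u) (take n ?W)" using n by blast
    then have "sublist (c # elem_alpha x y u) ?W"
      using sublist_order.order.trans sublist_take by blast
    then obtain p s where "?W = p @ (c # elem_alpha x y u) @ s" unfolding sublist_def by blast
    then have "?W = (p @ [c]) @ elem_alpha x y u @ s" by simp
    then obtain w1 w2 where w12: "w = w1 @ w2" "elem_alpha x y w2 = elem_alpha x y u @ s"
      using elem_alpha_split[OF neq] c(1) by (metis last_snoc)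
    have "elem_alpha x y u = [] \<or> last (elem_alpha x y u) \<noteq> x"
      using elem_alpha_last[OF neq c(1), of u] by auto
    then obtain w3 w4 where w34: "w2 = w3 @ w4" "elem_alpha x y w3 = elem_alpha x y u"
      using elem_alpha_split[OF neq w12(2)] by blast
    then have "w3 = u" using elem_alpha_inj[OF neq] by blast
    then show ?thesis using w12 w34 by simp
  qed
  then show ?thesis by blast
qed

text \<open>The letter \<open>c\<close> serves for \<open>a = y\<close>: there \<open>y\<close> must
  occur outside the blocks \<open>x y\<close>.\<close>

lemma letters_desub:
  assumes "\<forall>a. [a] \<in> T" "c \<noteq> x" "[c, y] \<in> T"
  shows "[a] \<in> desub x y T"
proof (cases "a = y")
  case True
  then show ?thesis unfolding desub_def using assms neq by auto
next
  case False
  have "elem_alpha x y [a] \<in> T" using elem_alpha_snoc[of "[]" a] assms(1) by simp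
  then obtain c where "c # elem_alpha x y [a] \<in> T" using left_extend[OF fact bi] by blast
  moreover from this have "c \<noteq> x" using not_x[of c a] not_x[of c x] False neq by (auto split: if_splits)
  ultimately show ?thesis unfolding desub_def by blast
qed

lemma thin_removable: "removable T x y \<Longrightarrow> thin x (two_sided_ext T (y # u))"
  unfolding thin_def removable_def mem_two_sided_ext
  by (metis append_Cons append1_eq_conv length_append_singleton)

text \<open>For the empty word \<open>x\<close> has no right neighbour but \<open>y\<close>; words
  that start with \<open>y\<close> are covered by \<open>removable\<close>; in front of any other
  nonempty word \<open>x\<close> does not occur.\<close>

lemma thin_image:
  assumes "removable T x y"
  shows "thin x (two_sided_ext T (elem_alpha x y w))"
proof (cases "elem_alpha x y w")
  case Nil
  then show ?thesis by (simp add: thin_def) (metis follow)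
next
  case (Cons d v)
  show ?thesis
  proof (cases "d = y")
    case True
    then show ?thesis using thin_removable[OF assms] Cons by simp
  next
    case False
    then show ?thesis using follow'' Cons unfolding thin_def by auto
  qed
qed

lemma Range_ext_y: "Range (two_sided_ext T (y # w)) = two_sided_ext T w `` {y}"
  by (intro set_eqI) (unfold Range_two_sided_ext[OF fact bi] Image_singleton_iff, simp)

lemma conn_desub:
  assumes "removable T x y" "\<forall>w\<in>T. conn S (two_sided_ext T w)"
  shows "conn S (two_sided_ext (desub x y T) w)"
  unfolding two_sided_ext_desub
  by (intro conn_split_vertex conn_two_sided_ext[OF fact] assms thin_image Range_ext_y neq)

end

lemma recurrent_dendric_desub:
  fixes T :: "'a::finite list set"
  assumes T: "recurrent_dendric T" and xy: "x \<noteq> y" "\<And>c. [x, c] \<in> T \<Longrightarrow> c = y"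
    and c: "c \<noteq> x" "[c, y] \<in> T" and rm: "removable T x y"
  shows "recurrent_dendric (desub x y T)"
proof -
  interpret desubstitution T x y
    using assms unfolding recurrent_dendric_def by unfold_locales auto
  have tree: "gtree (two_sided_ext (desub x y T) w)" if w: "w \<in> desub x y T" for w
  proof -
    have ne: "two_sided_ext (desub x y T) w \<noteq> {}"
      using biextendableD[OF biextendable_desub w] by (metis empty_iff mem_two_sided_ext)
    have "\<forall>w\<in>T. conn UNIV (two_sided_ext T w)" using T unfolding recurrent_dendric_def gtree_def by blast
    then have F: "conn UNIV (two_sided_ext T (y # elem_alpha x y w))" by (rule conn_two_sided_ext[OF fact])
    have E: "gtree (two_sided_ext T (elem_alpha x y w))"
      using T desub_image[OF w] unfolding recurrent_dendric_def by blast
    show ?thesis unfolding two_sided_ext_desub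
      using ne[unfolded two_sided_ext_desub]
      by (intro gtree_split_vertex E F thin_image thin_removable rm Range_ext_y neq) simp_all
  qed
  then show ?thesis
    using factorial_desub biextendable_desub recurrent_desub letters_desub[OF _ c] T
    unfolding recurrent_dendric_def by blast
qed

section \<open>Mirror images, for the moves by \<open>elem_alpha_tilde\<close>\<close>

lemma mem_rev_image [simp]: "w \<in> rev ` T \<longleftrightarrow> rev w \<in> T"
  by (metis image_iff rev_rev_ident)

lemma two_sided_ext_rev: "two_sided_ext (rev ` T) w = (two_sided_ext T (rev w))\<inverse>"
  by auto

lemma recurrent_dendric_rev:
  assumes "recurrent_dendric T"
  shows "recurrent_dendric (rev ` T)"
  unfolding recurrent_dendric_def
proof (intro conjI ballI allI)
  show "factorial (rev ` T)"
    using assms unfolding recurrent_dendric_def factorial_def by (metis mem_rev_image sublist_rev)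
  show "biextendable (rev ` T)"
    using assms unfolding recurrent_dendric_def biextendable_def by fastforce
  show "gtree (two_sided_ext (rev ` T) w)" if "w \<in> rev ` T" for w
    using assms that unfolding recurrent_dendric_def two_sided_ext_rev by (simp add: gtree_converse)
  show "[a] \<in> rev ` T" for a using assms unfolding recurrent_dendric_def by simp
  show "\<exists>n. \<forall>w\<in>rev ` T. length w = n \<longrightarrow> sublist u w" if u: "u \<in> rev ` T" for u
  proof -
    obtain n where "\<forall>w\<in>T. length w = n \<longrightarrow> sublist (rev u) w"
      using u assms unfolding recurrent_dendric_def by (metis mem_rev_image)
    then show ?thesis by (intro exI[of _ n]) (metis length_rev mem_rev_image sublist_rev)
  qed
qed

lemma elem_alpha_tilde_rev: "elem_alpha_tilde x y w = rev (elem_alpha x y (rev w))"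
  by (induction w) (auto simp: elem_alpha_tilde_def)

lemma Fac_rev: "Fac (rev ` W) = rev ` Fac W"
proof (intro set_eqI)
  fix u
  have "u \<in> Fac (rev ` W) \<longleftrightarrow> (\<exists>w\<in>W. sublist u (rev w))" unfolding Fac_def by blast
  also have "\<dots> \<longleftrightarrow> (\<exists>w\<in>W. sublist (rev u) w)" by (metis rev_rev_ident sublist_rev)
  finally show "u \<in> Fac (rev ` W) \<longleftrightarrow> u \<in> rev ` Fac W" by (simp add: Fac_def)
qed

subsection \<open>Existence of moves\<close>

lemma mem_map_prod_right: "(l, q) \<in> map_prod id f ` E \<longleftrightarrow> (\<exists>r. q = f r \<and> (l, r) \<in> E)"
  by force

lemma mem_map_prod_left: "(k, r) \<in> map_prod f id ` E \<longleftrightarrow> (\<exists>l. k = f l \<and> (l, r) \<in> E)"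
  by force

lemma gtree_collapse_left:
  assumes "finite E" "gtree E" "conn D (E\<inverse>)"
  shows "gtree (map_prod (collapse D) id ` E)"
proof -
  have "gtree ((map_prod id (collapse D) ` (E\<inverse>))\<inverse>)"
    using assms by (intro gtree_converse gtree_collapse) auto
  moreover have "(map_prod id (collapse D) ` (E\<inverse>))\<inverse> = map_prod (collapse D) id ` E"
    by (auto simp: mem_map_prod_left mem_map_prod_right simp del: map_prod_simp)
  ultimately show ?thesis by simp
qed

lemma two_le_card: "finite A \<Longrightarrow> a \<in> A \<Longrightarrow> b \<in> A \<Longrightarrow> a \<noteq> b \<Longrightarrow> 2 \<le> card A"
  using card_mono[of A "{a, b}"] by simp

text \<open>With \<open>D\<close> merged to \<open>None\<close>, the left extensions at each stage
  satisfy the count of a hypertree. If every element but \<open>None\<close> lay on two edges with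
  at least two elements, this count would be exceeded. Lying on two such edges persists at later
  stages, so some letter avoids it at all of them.\<close>

lemma removable_exists:
  fixes T :: "'a::finite list set"
  assumes T: "recurrent_dendric T" and D: "\<And>w. w \<in> T \<Longrightarrow> conn D ((two_sided_ext T w)\<inverse>)"
    and d: "d \<in> D" "[d, y] \<in> T" and e: "e \<notin> D" "[e, y] \<in> T"
  shows "\<exists>x. x \<notin> D \<and> [x, y] \<in> T \<and> removable T x y"
proof -
  have fb: "factorial T" "biextendable T" using T unfolding recurrent_dendric_def by auto
  define E where "E u = map_prod (collapse D) id ` two_sided_ext T (y # u)" for u
  \<comment> \<open>\<open>K u\<close> is the edge that belongs to \<open>y # u\<close>;
    \<open>W n\<close> indexes all edges of stage \<open>n\<close>, and \<open>B n\<close> those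
    with at least two elements.\<close>
  define K where "K u = {k. \<exists>l. k = collapse D l \<and> l # y # u \<in> T}" for u
  define W where "W n = {u. length u = n \<and> y # u \<in> T}" for n
  define B where "B n = {u \<in> W n. 2 \<le> card (K u)}" for n
  have E_iff: "(k, r) \<in> E u \<longleftrightarrow> k \<in> K (u @ [r])" for k r u
    unfolding E_def K_def mem_map_prod_left by simp
  have Dom: "Domain (E u) = K u" for u
  proof (intro set_eqI)
    fix k
    have "k \<in> Domain (E u) \<longleftrightarrow> (\<exists>l. k = collapse D l \<and> l \<in> Domain (two_sided_ext T (y # u)))"
      unfolding E_def Domain_iff mem_map_prod_left by blast
    then show "k \<in> Domain (E u) \<longleftrightarrow> k \<in> K u"
      unfolding Domain_two_sided_ext[OF fb] K_def by blast
  qed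
  have Ran: "r \<in> Range (E u) \<longleftrightarrow> y # u @ [r] \<in> T" for r u
  proof -
    have "Range (E u) = Range (two_sided_ext T (y # u))"
      unfolding E_def set_eq_iff Range_iff mem_map_prod_left by blast
    then show ?thesis using Range_two_sided_ext[OF fb, of r "y # u"] by simp
  qed
  have E: "gtree (E u)" if "y # u \<in> T" for u
    unfolding E_def using that T D by (intro gtree_collapse_left) (auto simp: recurrent_dendric_def)
  have finK: "finite (K u)" for u
    by (rule finite_subset[of _ "range (collapse D)"]) (auto simp: K_def)
  have finW: "finite (W n)" for n
    using finite_lists_length_eq[of "UNIV :: 'a set" n] by (rule finite_subset[rotated]) (auto simp: W_def)
  have finB: "finite (B n)" for n using finW[of n] by (simp add: B_def)
  have K1: "1 \<le> card (K u)" if u: "y # u \<in> T" for u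
  proof -
    obtain l where "l # y # u \<in> T" using left_extend[OF fb u] by blast
    then have "K u \<noteq> {}" unfolding K_def by blast
    then show ?thesis using finK by (simp add: Suc_le_eq card_gt_0_iff)
  qed
  have K_mono: "K u \<subseteq> K []" for u
    unfolding K_def using factorial_prefix[OF fb(1), of "[_, y]" u] by fastforce
  \<comment> \<open>The collapsed graph of \<open>y # u\<close> has the left side \<open>K u\<close>
    and an edge \<open>(k, r)\<close> for each \<open>k\<close> in \<open>K (u @ [r])\<close>; this
    is its tree count.\<close>
  have branch: "(\<Sum>r\<in>Range (E u). card (K (u @ [r])) - 1) \<le> card (K u) - 1" if u: "y # u \<in> T" for u
  proof -
    let ?R = "Range (E u)"
    have "(\<Sum>r\<in>?R. card (K (u @ [r])) - 1) + card ?R = (\<Sum>r\<in>?R. (card (K (u @ [r])) - 1) + 1)"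
      by (subst sum.distrib) simp
    also have "\<dots> = (\<Sum>r\<in>?R. card (K (u @ [r])))"
    proof (intro sum.cong refl)
      fix r assume "r \<in> ?R"
      then have "1 \<le> card (K (u @ [r]))" using K1[of "u @ [r]"] Ran by simp
      then show "card (K (u @ [r])) - 1 + 1 = card (K (u @ [r]))" by simp
    qed
    also have "\<dots> = card (SIGMA r:?R. K (u @ [r]))" using finK by (subst card_SigmaI) auto
    also have "(SIGMA r:?R. K (u @ [r])) = (E u)\<inverse>" using E_iff by auto
    finally have "(\<Sum>r\<in>?R. card (K (u @ [r])) - 1) + card ?R = card (E u)" by simp
    then show ?thesis using E[OF u] unfolding gtree_def Dom by linarith
  qed
  have stage: "(\<Sum>u\<in>W n. card (K u) - 1) \<le> card (K []) - 1" for n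
  proof (induction n)
    case 0
    have "W 0 = {[]}" using T by (auto simp: W_def recurrent_dendric_def)
    then show ?case by simp
  next
    case (Suc n)
    have W: "W (Suc n) = (\<lambda>(u, r). u @ [r]) ` (SIGMA u:W n. Range (E u))"
    proof (intro set_eqI iffI)
      fix v assume "v \<in> W (Suc n)"
      then have v: "length v = Suc n" "y # v \<in> T" by (auto simp: W_def)
      then obtain u r where ur: "v = u @ [r]" by (metis append_butlast_last_id length_0_conv nat.distinct(1))
      then have "u \<in> W n" "r \<in> Range (E u)"
        using v factorial_prefix[OF fb(1), of "y # u" "[r]"] Ran by (auto simp: W_def)
      then show "v \<in> (\<lambda>(u, r). u @ [r]) ` (SIGMA u:W n. Range (E u))" using ur by force
    next
      fix v assume "v \<in> (\<lambda>(u, r). u @ [r]) ` (SIGMA u:W n. Range (E u))"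
      then obtain u r where ur: "v = u @ [r]" "u \<in> W n" "r \<in> Range (E u)" by (auto simp del: Range_iff)
      then show "v \<in> W (Suc n)" using Ran[of r u] by (simp add: W_def)
    qed
    have inj: "inj_on (\<lambda>(u, r). u @ [r]) (SIGMA u:W n. Range (E u))" by (auto simp: inj_on_def)
    have "(\<Sum>u\<in>W (Suc n). card (K u) - 1) = (\<Sum>(u, r)\<in>(SIGMA u:W n. Range (E u)). card (K (u @ [r])) - 1)"
      unfolding W sum.reindex[OF inj] by (simp add: case_prod_unfold)
    also have "\<dots> = (\<Sum>u\<in>W n. \<Sum>r\<in>Range (E u). card (K (u @ [r])) - 1)"
      by (rule sum.Sigma[symmetric]) (use finW in auto)
    also have "\<dots> \<le> (\<Sum>u\<in>W n. card (K u) - 1)"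
      by (rule sum_mono, rule branch) (simp add: W_def)
    finally show ?case using Suc.IH by simp
  qed
  \<comment> \<open>In a connected graph \<open>k\<close> shares a right neighbour with another left
    vertex, so it stays on an edge with two elements.\<close>
  have extend: "\<exists>s. u @ [s] \<in> B (Suc n) \<and> k \<in> K (u @ [s])" if u: "u \<in> B n" "k \<in> K u" for u n k
  proof -
    have "\<not> K u \<subseteq> {k}" using u card_mono[of "{k}" "K u"] by (auto simp: B_def)
    then obtain k' where k': "k' \<in> K u" "k' \<noteq> k" by blast
    then obtain r r' where "(k, r) \<in> E u" "(k', r') \<in> E u" using u Dom by (metis DomainE)
    then obtain s h where s: "(k, s) \<in> E u" "(h, s) \<in> E u" "h \<noteq> k"
      using conn_shared[of "E u" k r k' r'] E u k' by (auto simp: gtree_def B_def W_def)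
    then have "k \<in> K (u @ [s])" "h \<in> K (u @ [s])" using E_iff by simp_all
    then have "2 \<le> card (K (u @ [s]))" using two_le_card[OF finK] s(3) by metis
    moreover have "y # u @ [s] \<in> T" using s Ran by (metis RangeI)
    ultimately show ?thesis using s u E_iff by (intro exI[of _ s]) (auto simp: B_def W_def)
  qed
  define bad where "bad n k \<longleftrightarrow> (\<exists>u\<in>B n. \<exists>v\<in>B n. u \<noteq> v \<and> k \<in> K u \<and> k \<in> K v)" for n k
  have bad_Suc: "bad (Suc n) k" if "bad n k" for n k
    using that extend unfolding bad_def by (metis append1_eq_conv)
  have bad_mono: "bad n k" if "m \<le> n" "bad m k" for m n k
    using that by (induction rule: dec_induct) (auto intro: bad_Suc)
  have two: "2 \<le> card (K [])" and None: "None \<in> K []"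
  proof -
    have "None = collapse D d" "Some e = collapse D e" using d e by (auto simp: collapse_def)
    then have *: "None \<in> K []" "Some e \<in> K []" using d(2) e(2) unfolding K_def by blast+
    then show "None \<in> K []" by simp
    show "2 \<le> card (K [])" by (rule two_le_card[OF finK *]) simp
  qed
  have good_stage: "\<exists>k\<in>K [] - {None}. \<not> bad n k" for n
  proof (rule ccontr)
    assume all: "\<not> ?thesis"
    have ex: "\<exists>u\<in>B n. k \<in> K u" if "k \<in> K []" for k n
    proof (induction n)
      case 0
      have "[] \<in> B 0" using T two by (auto simp: B_def W_def recurrent_dendric_def)
      then show ?case using that by blast
    next
      case (Suc n)
      then show ?case using extend by blast
    qed
    \<comment> \<open>Double counting of incidences between elements and edges in
      \<open>B n\<close>: by \<open>stage\<close> there are at most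
      \<open>2 * (card (K []) - 1)\<close>, as \<open>c \<le> 2 * (c - 1)\<close> for
      \<open>c \<ge> 2\<close>. But \<open>None\<close> lies on one edge, and all other elements are
      assumed to lie on two.\<close>
    let ?I = "\<lambda>k. {u \<in> B n. k \<in> K u}"
    have "(\<Sum>k\<in>K []. card (?I k)) = (\<Sum>u\<in>B n. card {k \<in> K []. k \<in> K u})"
      using sum.swap_restrict[of "K []" "B n" "\<lambda>_ _. 1 :: nat" "\<lambda>k u. k \<in> K u"] finK finB by simp
    also have "\<dots> = (\<Sum>u\<in>B n. card (K u))"
      by (intro sum.cong refl arg_cong[of _ _ card]) (use K_mono in auto)
    also have "\<dots> \<le> (\<Sum>u\<in>B n. 2 * (card (K u) - 1))"
      by (rule sum_mono) (auto simp: B_def)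
    also have "\<dots> = 2 * (\<Sum>u\<in>B n. card (K u) - 1)" by (simp add: sum_distrib_left)
    also have "(\<Sum>u\<in>B n. card (K u) - 1) \<le> (\<Sum>u\<in>W n. card (K u) - 1)"
      by (rule sum_mono2) (use finW in \<open>auto simp: B_def\<close>)
    finally have upper: "(\<Sum>k\<in>K []. card (?I k)) \<le> 2 * (card (K []) - 1)" using stage[of n] by linarith
    have "2 \<le> card (?I k)" if k: "k \<in> K [] - {None}" for k
    proof -
      obtain u v where "u \<in> B n" "v \<in> B n" "u \<noteq> v" "k \<in> K u" "k \<in> K v"
        using all k unfolding bad_def by blast
      then have "{u, v} \<subseteq> ?I k" "card {u, v} = 2" by auto
      then show ?thesis using card_mono[of "?I k" "{u, v}"] finB[of n] by simp
    qed
    then have "(\<Sum>k\<in>K [] - {None}. 2) \<le> (\<Sum>k\<in>K [] - {None}. card (?I k))" by (rule sum_mono)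
    moreover have "card (?I None) \<noteq> 0" using ex[OF None, of n] finB[of n] by auto
    ultimately have "2 * (card (K []) - 1) + 1 \<le> (\<Sum>k\<in>K []. card (?I k))"
      using None finK[of "[]"] by (subst sum.remove[of _ None]) auto
    then show False using upper by simp
  qed
  show ?thesis
  proof (rule ccontr)
    assume neg: "\<not> ?thesis"
    have "\<forall>k\<in>K [] - {None}. \<exists>n. bad n k"
    proof
      fix k assume k: "k \<in> K [] - {None}"
      then obtain x where x: "k = Some x" "x \<notin> D" "[x, y] \<in> T" by (auto simp: K_def collapse_def split: if_splits)
      then have "\<not> removable T x y" using neg by blast
      then obtain u v c c' where uv: "length u = length v" "x # y # u \<in> T" "x # y # v \<in> T" "u \<noteq> v"
        "c \<noteq> x" "c # y # u \<in> T" "c' \<noteq> x" "c' # y # v \<in> T" unfolding removable_def by blast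
      have "q \<in> B (length q) \<and> k \<in> K q" if q: "x # y # q \<in> T" "c # y # q \<in> T" "c \<noteq> x" for q c
      proof -
        have "k = collapse D x" using x by (simp add: collapse_def)
        then have k: "k \<in> K q" "collapse D c \<in> K q" using q unfolding K_def by blast+
        moreover have "k \<noteq> collapse D c" using q x by (auto simp: collapse_def)
        then have "2 \<le> card (K q)" by (rule two_le_card[OF finK k])
        moreover have "y # q \<in> T" using q factorial_tl[OF fb(1)] by blast
        ultimately show ?thesis by (auto simp: B_def W_def)
      qed
      from this[of u c] this[of v c'] have "bad (length u) k" using uv unfolding bad_def by metis
      then show "\<exists>n. bad n k" ..
    qed
    then obtain f where f: "\<And>k. k \<in> K [] - {None} \<Longrightarrow> bad (f k) k" by metis
    \<comment> \<open>The sum of the individual stages is a common later stage for all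
      elements.\<close>
    have "bad (sum f (K [] - {None})) k" if k: "k \<in> K [] - {None}" for k
    proof (rule bad_mono[OF _ f[OF k]])
      show "f k \<le> sum f (K [] - {None})" using finK[of "[]"] k by (intro member_le_sum) auto
    qed
    then show False using good_stage by blast
  qed
qed

lemma power_not_mem:
  assumes T: "recurrent_dendric T" and "c \<noteq> a"
  shows "\<exists>k. replicate k a \<notin> T"
proof -
  obtain n where n: "\<And>w. w \<in> T \<Longrightarrow> length w = n \<Longrightarrow> sublist [c] w"
    using T unfolding recurrent_dendric_def by metis
  have "\<not> sublist [c] (replicate n a)"
    using assms(2) set_mono_sublist[of "[c]" "replicate n a"] by auto
  then show ?thesis using n by (metis length_replicate)
qed

text \<open>Otherwise all powers of \<open>y\<close> would belong to \<open>T\<close>.\<close>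

lemma other_successor:
  assumes T: "recurrent_dendric T" and "c \<noteq> y"
  shows "\<exists>c'. c' \<noteq> y \<and> [y, c'] \<in> T"
proof (rule ccontr)
  assume neg: "\<not> ?thesis"
  have fb: "factorial T" "biextendable T" using T unfolding recurrent_dendric_def by auto
  have "replicate (Suc k) y \<in> T" for k
  proof (induction k)
    case 0
    then show ?case using T by (simp add: recurrent_dendric_def)
  next
    case (Suc k)
    then obtain b where b: "replicate (Suc k) y @ [b] \<in> T" using right_extend[OF fb] by blast
    then have "replicate k y @ [y, b] \<in> T" by (simp flip: replicate_append_same)
    then have "[y, b] \<in> T" using factorial_suffix[OF fb(1)] by blast
    then have "b = y" using neg by blast
    then show ?case using b by (simp add: replicate_append_same)
  qed
  moreover obtain k where "replicate k y \<notin> T" using power_not_mem[OF assms] by blast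
  moreover have "[] \<in> T" using fb T factorial_prefix[of T "[]" "[y]"] by (simp add: recurrent_dendric_def)
  ultimately show False by (cases k) auto
qed

text \<open>\<open>Z\<close> and \<open>Z'\<close> are the marked letters before and after the move.
  The two cases of \<open>gtree_bunch\<close> for the collapsed graph of the empty word give letters
  always followed by \<open>y\<close>, or always preceded by \<open>x\<close>.\<close>

lemma elementary_step:
  fixes T :: "'a::finite list set"
  assumes T: "recurrent_dendric T" and Z: "Z \<noteq> {}" "Z \<noteq> UNIV" "\<And>w. w \<in> T \<Longrightarrow> conn Z (two_sided_ext T w)"
  shows "\<exists>x y \<sigma> T' Z'. x \<noteq> y \<and> y \<notin> Z \<and>
      (\<sigma> = elem_alpha x y \<and> Z' = Z \<or>
       \<sigma> = elem_alpha_tilde y x \<and> Z' = (if x \<in> Z then insert y Z else Z)) \<and>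
      recurrent_dendric T' \<and> T = Fac (\<sigma> ` T') \<and> (\<forall>w\<in>T'. conn Z' (two_sided_ext T' w))"
proof -
  have fb: "factorial T" "biextendable T" and letters: "\<And>a. [a] \<in> T"
    using T unfolding recurrent_dendric_def by auto
  have nil: "[] \<in> T" using letters factorial_prefix[OF fb(1), of "[]" "[undefined]"] by simp
  define G where "G = map_prod id (collapse Z) ` two_sided_ext T []"
  have G: "(l, q) \<in> G \<longleftrightarrow> (\<exists>r. q = collapse Z r \<and> [l, r] \<in> T)" for l q
    unfolding G_def mem_map_prod_right by simp
  have treeG: "gtree G" unfolding G_def
    using T Z(3)[OF nil] nil by (intro gtree_collapse) (auto simp: recurrent_dendric_def)
  have ran: "collapse Z r \<in> Range G" for r
    using left_extend[OF fb letters[of r]] G by blast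
  have rootG: "None \<in> Range G" "Range G \<noteq> {None}"
  proof -
    obtain z z' where z: "z \<in> Z" "z' \<notin> Z" using Z by blast
    then have "collapse Z z = None" "collapse Z z' = Some z'" by simp_all
    then have *: "None \<in> Range G" "Some z' \<in> Range G" using ran by metis+
    then show "None \<in> Range G" by simp
    show "Range G \<noteq> {None}" using *(2) by (metis option.distinct(1) singletonD)
  qed
  have finG: "finite G" unfolding G_def by simp
  from finG treeG rootG show ?thesis
  proof (cases rule: gtree_bunch)
    case (left_leaves q d)
    obtain y where y: "q = Some y" "y \<notin> Z" "[d, y] \<in> T"
    proof -
      obtain r where "q = collapse Z r" "[d, r] \<in> T" using left_leaves(2) G by blast
      then show ?thesis using that[of r] left_leaves(1) by (auto simp: collapse_def split: if_splits)
    qed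
    obtain e where e: "e \<noteq> d" "[e, y] \<in> T" using left_leaves(3) y(1) G by (metis collapse_eq_Some)
    \<comment> \<open>Taking \<open>D = {d}\<close> avoids the one left neighbour of
      \<open>y\<close> that may have other successors, and keeps \<open>d\<close> as a predecessor
      of \<open>y\<close> other than \<open>x\<close>.\<close>
    obtain x where x: "x \<noteq> d" "[x, y] \<in> T" "removable T x y"
      using removable_exists[OF T conn_singleton, of d d y e] y e by auto
    have follow: "c = y" if "[x, c] \<in> T" for c
    proof -
      have "(x, Some y) \<in> G" using x(2) y(2) G by (auto simp: collapse_def)
      moreover have "(x, collapse Z c) \<in> G" using that G by blast
      ultimately have "collapse Z c = Some y" using left_leaves(4) x(1) y(1) by blast
      then show ?thesis by simp
    qed
    have "x \<noteq> y" using other_successor[OF T, of d x] follow x(1) by metis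
    interpret desubstitution T x y using fb \<open>x \<noteq> y\<close> follow by unfold_locales auto
    have "recurrent_dendric (desub x y T)"
      by (rule recurrent_dendric_desub[OF T \<open>x \<noteq> y\<close> follow x(1)[symmetric] y(3) x(3)])
    moreover have "\<forall>w\<in>desub x y T. conn Z (two_sided_ext (desub x y T) w)"
      using conn_desub[OF x(3)] Z(3) by blast
    ultimately show ?thesis
      using \<open>x \<noteq> y\<close> y(2) Fac_desub
      by (intro exI[of _ x] exI[of _ y] exI[of _ "elem_alpha x y"] exI[of _ "desub x y T"] exI[of _ Z] conjI) simp_all
  next
    case (right_leaves x p)
    let ?R = "rev ` T"
    have R: "recurrent_dendric ?R" using T by (rule recurrent_dendric_rev)
    \<comment> \<open>The fibre of \<open>p\<close> is \<open>Z\<close> or a single letter, hence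
      connected in the graphs. A successor \<open>y\<close> of \<open>x\<close> outside it is
      unmarked and preceded only by \<open>x\<close>.\<close>
    define D where "D = {r. collapse Z r = p}"
    obtain d where d: "d \<in> D" "[x, d] \<in> T" using right_leaves(1) G by (auto simp: D_def)
    obtain e where e: "e \<notin> D" "[x, e] \<in> T" using right_leaves(2) G by (auto simp: D_def)
    have "D = Z \<or> D = {d}" using d(1) by (auto simp: D_def collapse_def split: if_splits)
    then have "conn D ((two_sided_ext ?R w)\<inverse>)" if "w \<in> ?R" for w
      using that Z(3) conn_singleton[of d] unfolding two_sided_ext_rev converse_converse by auto
    then obtain y where y: "y \<notin> D" "[y, x] \<in> ?R" "removable ?R y x"
      using removable_exists[OF R, of D d x e] d e by auto
    have xy: "(x, collapse Z y) \<in> G" "collapse Z y \<noteq> p" using y(1,2) G by (auto simp: D_def)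
    then have "y \<notin> Z" using right_leaves(3) by fastforce
    have follow: "c = x" if "[y, c] \<in> ?R" for c
    proof -
      have "(c, collapse Z y) \<in> G" using that G by auto
      then show ?thesis using right_leaves(4) xy by blast
    qed
    have "y \<noteq> x" using other_successor[OF R, of d y] follow y(1) d(1) by metis
    interpret desubstitution ?R y x
      using R \<open>y \<noteq> x\<close> follow by unfold_locales (auto simp: recurrent_dendric_def)
    let ?D = "desub y x ?R"
    have "recurrent_dendric ?D"
      by (rule recurrent_dendric_desub[OF R \<open>y \<noteq> x\<close> follow _ _ y(3), where c = d]) (use y(1) d in auto)
    then have "recurrent_dendric (rev ` ?D)" by (rule recurrent_dendric_rev)
    moreover have "T = Fac (elem_alpha_tilde y x ` rev ` ?D)"
    proof -
      have "elem_alpha_tilde y x ` rev ` ?D = rev ` elem_alpha y x ` ?D"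
        unfolding image_image elem_alpha_tilde_rev by simp
      then have "Fac (elem_alpha_tilde y x ` rev ` ?D) = rev ` Fac (elem_alpha y x ` ?D)"
        by (simp only: Fac_rev)
      also have "\<dots> = rev ` ?R" using Fac_desub by (rule arg_cong[OF sym])
      finally show ?thesis by (simp add: image_image)
    qed
    \<comment> \<open>Read in \<open>T\<close>, the mirror move splits the right vertex
      \<open>x\<close> into \<open>x\<close> and \<open>y\<close>, so \<open>y\<close> inherits the
      mark of \<open>x\<close>.\<close>
    moreover have "conn (if x \<in> Z then insert y Z else Z) (two_sided_ext (rev ` ?D) w)" for w
    proof -
      let ?v = "elem_alpha y x (rev w)"
      have "Domain (two_sided_ext T (rev (x # ?v))) = (two_sided_ext T (rev ?v))\<inverse> `` {x}"
        by (intro set_eqI) (unfold Domain_two_sided_ext[OF fb] Image_singleton_iff, simp)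
      moreover have "\<forall>w\<in>T. conn UNIV (two_sided_ext T w)"
        using T unfolding recurrent_dendric_def gtree_def by blast
      ultimately show ?thesis
        unfolding two_sided_ext_rev[of ?D] two_sided_ext_desub two_sided_ext_rev[of T]
        using \<open>y \<noteq> x\<close> \<open>y \<notin> Z\<close> Z(3)
        by (intro conn_split_vertex_converse conn_two_sided_ext[OF fb(1)]) blast+
    qed
    ultimately show ?thesis using \<open>y \<noteq> x\<close> \<open>y \<notin> Z\<close>
      by (intro exI[of _ x] exI[of _ y] exI[of _ "elem_alpha_tilde y x"] exI[of _ "rev ` ?D"]
          exI[of _ "if x \<in> Z then insert y Z else Z"] conjI) simp_all
  qed
qed

subsection \<open>Blocks and growth\<close>

text \<open>The last condition traces letters back through products; it carries primitivity from
  borders of blocks to arbitrary indices.\<close>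

definition positive :: "('a list \<Rightarrow> 'b list) \<Rightarrow> bool" where
  "positive f \<longleftrightarrow> (\<forall>u v. f (u @ v) = f u @ f v) \<and> (\<forall>c. f [c] \<noteq> []) \<and> (\<forall>b. \<exists>c. b \<in> set (f [c]))"

lemma positive_append: "positive f \<Longrightarrow> f (u @ v) = f u @ f v"
  unfolding positive_def by blast

lemma positive_Nil: "positive f \<Longrightarrow> f [] = []"
  using positive_append[of f "[]" "[]"] by simp

lemma positive_Cons: "positive f \<Longrightarrow> f (c # w) = f [c] @ f w"
  using positive_append[of f "[c]" w] by simp

lemma positive_word_morphism:
  "(\<And>c. h c \<noteq> []) \<Longrightarrow> (\<And>b. \<exists>c. b \<in> set (h c)) \<Longrightarrow> positive (word_morphism h)"
  unfolding positive_def by simp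

lemma positive_elementary: "f \<in> elementary_positive \<Longrightarrow> positive f"
proof -
  have "positive (elem_alpha a b)" for a b :: 'a
    unfolding elem_alpha_def by (rule positive_word_morphism) (auto intro: exI[of _ "_ :: 'a"])
  moreover have "positive (elem_alpha_tilde a b)" for a b :: 'a
    unfolding elem_alpha_tilde_def by (rule positive_word_morphism) (auto intro: exI[of _ "_ :: 'a"])
  moreover have "positive (perm_morphism \<pi>)" if "bij \<pi>" for \<pi> :: "'a \<Rightarrow> 'a"
    unfolding perm_morphism_def using surjD[OF bij_is_surj[OF that]]
    by (intro positive_word_morphism) auto
  ultimately show "f \<in> elementary_positive \<Longrightarrow> positive f" unfolding elementary_positive_def by blast
qed

lemma positive_id: "positive id"
  unfolding positive_def by (auto intro: exI[of _ "_ :: 'a"])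

lemma positive_mem:
  assumes "positive f"
  shows "b \<in> set (f w) \<longleftrightarrow> (\<exists>c\<in>set w. b \<in> set (f [c]))"
proof (induction w)
  case Nil
  then show ?case using positive_Nil[OF assms] by simp
next
  case (Cons c w)
  then show ?case using positive_Cons[OF assms, of c w] by simp
qed

lemma positive_length:
  assumes "positive f" "\<And>c. N \<le> length (f [c])"
  shows "N * length w \<le> length (f w)"
proof (induction w)
  case (Cons c w)
  then show ?case using assms(2)[of c] positive_Cons[OF assms(1), of c w] by simp
qed simp

lemma positive_length_ge: "positive f \<Longrightarrow> length w \<le> length (f w)"
  using positive_length[of f 1 w] by (simp add: positive_def Suc_le_eq)

lemma positive_comp:
  assumes f: "positive f" and g: "positive g"
  shows "positive (f \<circ> g)"
  unfolding positive_def
proof (intro conjI allI)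
  show "(f \<circ> g) (u @ v) = (f \<circ> g) u @ (f \<circ> g) v" for u v
    using assms by (simp add: positive_append)
  show "(f \<circ> g) [c] \<noteq> []" for c
    using positive_length_ge[OF f, of "g [c]"] positive_length_ge[OF g, of "[c]"] by auto
  fix b
  obtain c where c: "b \<in> set (f [c])" using f unfolding positive_def by blast
  obtain d where "c \<in> set (g [d])" using g unfolding positive_def by blast
  then have "b \<in> set ((f \<circ> g) [d])" using c positive_mem[OF f, of b "g [d]"] by auto
  then show "\<exists>d. b \<in> set ((f \<circ> g) [d])" ..
qed

lemma positive_foldr: "(\<And>f. f \<in> set fs \<Longrightarrow> positive f) \<Longrightarrow> positive (foldr (\<circ>) fs id)"
proof (induction fs)
  case (Cons f fs)
  have "positive (foldr (\<circ>) fs id)" by (rule Cons.IH) (use Cons.prems in simp)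
  then have "positive (f \<circ> foldr (\<circ>) fs id)" by (rule positive_comp[rotated]) (use Cons.prems in simp)
  moreover have "foldr (\<circ>) (f # fs) id = f \<circ> foldr (\<circ>) fs id" by simp
  ultimately show ?case by (simp only:)
qed (simp add: positive_id)

lemma foldr_comp_append: "foldr (\<circ>) (fs @ gs) id = foldr (\<circ>) fs id \<circ> foldr (\<circ>) gs id"
  by (induction fs) (simp_all add: comp_assoc)

lemma positive_sublist: "positive f \<Longrightarrow> sublist u v \<Longrightarrow> sublist (f u) (f v)"
  unfolding sublist_def by (metis positive_append)

lemma Fac_image_Fac:
  assumes "positive f"
  shows "Fac (f ` Fac W) = Fac (f ` W)"
proof
  show "Fac (f ` Fac W) \<subseteq> Fac (f ` W)"
  proof
    fix u assume "u \<in> Fac (f ` Fac W)"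
    then obtain v w where vw: "sublist u (f v)" "w \<in> W" "sublist v w" unfolding Fac_def by blast
    then have "sublist u (f w)"
      using positive_sublist[OF assms] sublist_order.order.trans by blast
    then show "u \<in> Fac (f ` W)" using vw unfolding Fac_def by blast
  qed
  show "Fac (f ` W) \<subseteq> Fac (f ` Fac W)" unfolding Fac_def by blast
qed

text \<open>Each move lengthens an image, while the total length \<open>size\<close> stays bounded.
  A move exists as long as some letter is unmarked, so all letters become marked.\<close>

lemma block_exists:
  fixes T :: "'a::finite list set"
  assumes T: "recurrent_dendric T" and ab: "b \<noteq> a"
  shows "\<exists>ss T'. set ss \<subseteq> elementary_positive \<and> ss \<noteq> [] \<and> recurrent_dendric T' \<and>
    T = Fac (foldr (\<circ>) ss id ` T') \<and> (\<forall>c. \<exists>u. foldr (\<circ>) ss id [c] = a # u)"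
proof -
  have fact: "factorial T" using T unfolding recurrent_dendric_def by blast
  \<comment> \<open>\<open>ss\<close> lists the moves so far, \<open>T'\<close> is the desubstituted
    set, and \<open>Z\<close> contains the marked letters, whose images have their only
    \<open>a\<close> in front.\<close>
  define inv where "inv ss T' Z \<longleftrightarrow> set ss \<subseteq> elementary_positive \<and> recurrent_dendric T' \<and>
    T = Fac (foldr (\<circ>) ss id ` T') \<and> Z \<noteq> {} \<and> (\<forall>w\<in>T'. conn Z (two_sided_ext T' w)) \<and>
    (\<forall>c\<in>Z. \<exists>u. foldr (\<circ>) ss id [c] = a # u \<and> a \<notin> set u) \<and>
    (\<forall>c. c \<notin> Z \<longrightarrow> a \<notin> set (foldr (\<circ>) ss id [c]))" for ss T' Z
  define size where "size ss = (\<Sum>c\<in>UNIV. length (foldr (\<circ>) ss id [c :: 'a] :: 'a list))" for ss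
  obtain n where n: "\<And>w. w \<in> T \<Longrightarrow> length w = n \<Longrightarrow> sublist [a] w"
    using T unfolding recurrent_dendric_def by metis
  have free: "length w \<le> n" if "w \<in> T" "a \<notin> set w" for w
  proof (rule ccontr)
    assume "\<not> length w \<le> n"
    moreover have "take n w \<in> T" using factorial_prefix[OF fact, of "take n w" "drop n w"] that by simp
    ultimately have "sublist [a] (take n w)" using n by simp
    then have "a \<in> set (take n w)" using set_mono_sublist by fastforce
    then show False using that in_set_takeD by metis
  qed
  have size_le: "size ss \<le> card (UNIV :: 'a set) * Suc n" if inv: "inv ss T' Z" for ss T' Z
  proof -
    let ?f = "foldr (\<circ>) ss id"
    \<comment> \<open>The image lies in \<open>T\<close> because \<open>[c]\<close> lies in
      \<open>T'\<close>; apart from a possible initial \<open>a\<close> it is free of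
      \<open>a\<close>, so \<open>free\<close> bounds it.\<close>
    have "length (?f [c]) \<le> Suc n" for c
    proof -
      have fc: "?f [c] \<in> T" using inv unfolding inv_def recurrent_dendric_def Fac_def by blast
      show ?thesis
      proof (cases "c \<in> Z")
        case True
        then obtain u where u: "?f [c] = a # u" "a \<notin> set u" using inv unfolding inv_def by blast
        then have "length u \<le> n" using free fc factorial_tl[OF fact] by metis
        then show ?thesis using u by simp
      next
        case False
        then show ?thesis using free[OF fc] inv unfolding inv_def by simp
      qed
    qed
    then show ?thesis unfolding size_def using sum_bounded_above[of UNIV "\<lambda>c. length (?f [c])" "Suc n"] by simp
  qed
  have step: "\<exists>\<sigma> T2 Z2. inv (ss @ [\<sigma>]) T2 Z2 \<and> size ss < size (ss @ [\<sigma>])"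
    if inv: "inv ss T1 Z" and Z: "Z \<noteq> UNIV" for ss T1 Z
  proof -
    let ?f = "foldr (\<circ>) ss id"
    have f: "positive ?f" using inv positive_elementary unfolding inv_def by (intro positive_foldr) blast
    have T1: "recurrent_dendric T1" "Z \<noteq> {}" "\<And>w. w \<in> T1 \<Longrightarrow> conn Z (two_sided_ext T1 w)"
      using inv unfolding inv_def by auto
    obtain x y \<sigma> T2 Z2 where s: "x \<noteq> y" "y \<notin> Z"
      "\<sigma> = elem_alpha x y \<and> Z2 = Z \<or> \<sigma> = elem_alpha_tilde y x \<and> Z2 = (if x \<in> Z then insert y Z else Z)"
      "recurrent_dendric T2" "T1 = Fac (\<sigma> ` T2)" "\<forall>w\<in>T2. conn Z2 (two_sided_ext T2 w)"
      using elementary_step[OF T1(1,2) Z T1(3)] by blast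
    have g: "foldr (\<circ>) (ss @ [\<sigma>]) id = ?f \<circ> \<sigma>" by (simp add: foldr_comp_append del: foldr_append)
    have \<sigma>: "\<sigma> \<in> elementary_positive" using s(1,3) unfolding elementary_positive_def by blast
    \<comment> \<open>\<open>z\<close> is the letter whose image changes; in both moves the new
      image is that of \<open>x\<close> followed by that of \<open>y\<close>.\<close>
    obtain z where z: "z = x \<and> \<sigma> = elem_alpha x y \<and> Z2 = Z \<or>
      z = y \<and> \<sigma> = elem_alpha_tilde y x \<and> Z2 = (if x \<in> Z then insert y Z else Z)"
      using s(3) by blast
    have img: "(?f \<circ> \<sigma>) [c] = (if c = z then ?f [x] @ ?f [y] else ?f [c])" for c
      using z positive_Cons[OF f, of x "[y]"] by (auto simp: elem_alpha_tilde_def)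
    have "inv (ss @ [\<sigma>]) T2 Z2" unfolding inv_def g
    proof (intro conjI allI impI ballI)
      show "set (ss @ [\<sigma>]) \<subseteq> elementary_positive" using inv \<sigma> unfolding inv_def by simp
      show "recurrent_dendric T2" by fact
      have "T = Fac (?f ` Fac (\<sigma> ` T2))" using inv s(5) unfolding inv_def by simp
      then show "T = Fac ((?f \<circ> \<sigma>) ` T2)" by (simp add: Fac_image_Fac[OF f] image_comp)
      show "Z2 \<noteq> {}" using s(3) T1(2) by (auto split: if_splits)
      show "conn Z2 (two_sided_ext T2 w)" if "w \<in> T2" for w using s(6) that by blast
      have a: "a \<notin> set (?f [c])" if "c \<notin> Z" for c using inv that unfolding inv_def by blast
      have az: "\<exists>u. ?f [c] = a # u \<and> a \<notin> set u" if "c \<in> Z" for c using inv that unfolding inv_def by blast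
      have Z2: "c \<in> Z2 \<longleftrightarrow> (if c = z then x \<in> Z else c \<in> Z)" for c
        using s(1,2) z by (auto split: if_splits)
      show "\<exists>u. (?f \<circ> \<sigma>) [c] = a # u \<and> a \<notin> set u" if c: "c \<in> Z2" for c
      proof (cases "c = z")
        case True
        then obtain u where "?f [x] = a # u" "a \<notin> set u" using az[of x] c Z2[of c] by auto
        then show ?thesis unfolding img using True a[OF s(2)] by simp
      qed (use az c Z2 img in auto)
      show "a \<notin> set ((?f \<circ> \<sigma>) [c])" if "c \<notin> Z2" for c
        unfolding img using a s(2) that Z2[of c] by (auto split: if_splits)
    qed
    moreover have "size ss < size (ss @ [\<sigma>])" unfolding size_def g
    proof (rule sum_strict_mono_ex1)
      have "z = x \<or> z = y" using z by blast
      then show "\<forall>c\<in>UNIV. length (?f [c]) \<le> length ((?f \<circ> \<sigma>) [c])" unfolding img by auto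
      show "\<exists>c\<in>UNIV. length (?f [c]) < length ((?f \<circ> \<sigma>) [c])"
      proof
        have "?f [x] \<noteq> []" "?f [y] \<noteq> []" using f unfolding positive_def by blast+
        then show "length (?f [z]) < length ((?f \<circ> \<sigma>) [z])"
          unfolding img using \<open>z = x \<or> z = y\<close> by auto
      qed simp
    qed simp
    ultimately show ?thesis by blast
  qed
  have "\<exists>ss' T'. inv ss' T' UNIV" if "inv ss T1 Z" for ss T1 Z
    using that
  proof (induction "card (UNIV :: 'a set) * Suc n - size ss" arbitrary: ss T1 Z rule: less_induct)
    case less
    show ?case
    proof (cases "Z = UNIV")
      case True
      then show ?thesis using less.prems by blast
    next
      case False
      then obtain \<sigma> T2 Z2 where s: "inv (ss @ [\<sigma>]) T2 Z2" "size ss < size (ss @ [\<sigma>])"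
        using step[OF less.prems] by blast
      then have "card (UNIV :: 'a set) * Suc n - size (ss @ [\<sigma>]) < card (UNIV :: 'a set) * Suc n - size ss"
        using size_le[OF s(1)] by linarith
      then show ?thesis using less.hyps s(1) by blast
    qed
  qed
  moreover have "inv [] T {a}"
    unfolding inv_def using T fact conn_singleton[of a] by (auto simp: Fac_def factorial_def)
  ultimately obtain ss T' where ss: "inv ss T' UNIV" by blast
  then have start: "\<exists>u. foldr (\<circ>) ss id [c] = a # u" for c unfolding inv_def by blast
  \<comment> \<open>For the empty list the image of \<open>b\<close> would start with
    \<open>b\<close>.\<close>
  then have "ss \<noteq> []" using start[of b] ab by auto
  then show ?thesis using ss start unfolding inv_def by blast
qed

section \<open>Products of consecutive morphisms\<close>

lemma morphism_prod_refl [simp]: "morphism_prod \<sigma> r r = id"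
  by (simp add: morphism_prod_def)

lemma morphism_prod_split:
  assumes "r \<le> s" "s \<le> t"
  shows "morphism_prod \<sigma> r t = morphism_prod \<sigma> r s \<circ> morphism_prod \<sigma> s t"
proof -
  have "[r..<t] = [r..<s] @ [s..<t]" using assms by (metis le_add_diff_inverse upt_add_eq_append)
  then show ?thesis unfolding morphism_prod_def by (simp add: foldr_comp_append del: foldr_append)
qed

lemma morphism_prod_Suc_left: "r < s \<Longrightarrow> morphism_prod \<sigma> r s = \<sigma> r \<circ> morphism_prod \<sigma> (Suc r) s"
  by (simp add: morphism_prod_def upt_conv_Cons)

lemma positive_morphism_prod: "(\<And>n. positive (\<sigma> n)) \<Longrightarrow> positive (morphism_prod \<sigma> r s)"
  unfolding morphism_prod_def by (rule positive_foldr) auto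

text \<open>A word that is no longer than the image of any letter cannot cross two borders between
  images.\<close>

lemma short_factor:
  assumes f: "positive f" and w: "\<And>c. length w \<le> length (f [c])" and "sublist w (f v)"
  shows "\<exists>u. sublist u v \<and> length u \<le> 2 \<and> sublist w (f u)"
  using assms(3)
proof (induction v)
  case Nil
  then show ?case by (intro exI[of _ "[]"]) simp
next
  case (Cons c v)
  have "sublist w (f [c] @ f v)" using Cons.prems positive_Cons[OF f, of c v] by simp
  then consider "sublist w (f [c])" | "sublist w (f v)"
    | w1 w2 where "w = w1 @ w2" "suffix w1 (f [c])" "prefix w2 (f v)"
    unfolding sublist_append by blast
  then show ?case
  proof cases
    case 1
    then show ?thesis by (intro exI[of _ "[c]"]) simp
  next
    case 2
    then obtain u where "sublist u v" "length u \<le> 2" "sublist w (f u)" using Cons.IH by blast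
    then show ?thesis by (intro exI[of _ u]) (simp add: sublist_Cons_right)
  next
    case 3
    show ?thesis
    proof (cases v)
      case Nil
      then show ?thesis using 3 positive_Nil[OF f]
        by (intro exI[of _ "[c]"]) (auto simp: suffix_imp_sublist)
    next
      case v: (Cons d v')
      have "f v = f [d] @ f v'" using v positive_Cons[OF f, of d v'] by simp
      moreover have "length w2 \<le> length (f [d])" using w[of d] 3(1) by simp
      ultimately have "prefix w2 (f [d])"
        using 3(3) by (metis append_eq_conv_conj prefix_def prefix_length_prefix)
      then have "sublist w (f [c] @ f [d])" using 3 unfolding sublist_append by blast
      then have "sublist w (f [c, d])" using positive_Cons[OF f, of c "[d]"] by simp
      moreover have "sublist [c, d] (c # v)" using v by (auto simp: sublist_def intro: exI[of _ "[]"])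
      ultimately show ?thesis by (intro exI[of _ "[c, d]"]) simp
    qed
  qed
qed

lemma long_words_contain_letters:
  fixes T :: "'a::finite list set"
  assumes T: "recurrent_dendric T"
  shows "\<exists>N. \<forall>w\<in>T. N \<le> length w \<longrightarrow> (\<forall>b. b \<in> set w)"
proof -
  have "\<forall>b. \<exists>n. \<forall>w\<in>T. length w = n \<longrightarrow> sublist [b] w"
    using T unfolding recurrent_dendric_def by blast
  then obtain n where n: "\<And>b w. w \<in> T \<Longrightarrow> length w = n b \<Longrightarrow> sublist [b] w" by metis
  have "b \<in> set w" if w: "w \<in> T" "sum n UNIV \<le> length w" for b w
  proof -
    have "n b \<le> sum n UNIV" by (rule member_le_sum) auto
    then have "length (take (n b) w) = n b" using w by simp
    moreover have "take (n b) w \<in> T"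
      using w T factorial_prefix[of T "take (n b) w" "drop (n b) w"] by (simp add: recurrent_dendric_def)
    ultimately have "sublist [b] (take (n b) w)" using n by blast
    then have "b \<in> set (take (n b) w)" using set_mono_sublist by fastforce
    then show ?thesis using in_set_takeD by metis
  qed
  then show ?thesis by blast
qed

section \<open>Growth and limit of a sequence of blocks\<close>

locale block_sequence =
  fixes T :: "nat \<Rightarrow> 'a::finite list set" and \<beta> :: "nat \<Rightarrow> 'a list \<Rightarrow> 'a list" and a b :: 'a
  assumes T: "\<And>n. recurrent_dendric (T n)" and \<beta>: "\<And>n. positive (\<beta> n)"
    and T_Suc: "\<And>n. T n = Fac (\<beta> n ` T (Suc n))" and start: "\<And>n c. \<exists>u. \<beta> n [c] = a # u"
    and ab: "b \<noteq> a"
begin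

lemma fact: "factorial (T n)" and bi: "biextendable (T n)" and letter: "[c] \<in> T n"
  using T[of n] unfolding recurrent_dendric_def by auto

lemma \<beta>_mem: "w \<in> T (Suc n) \<Longrightarrow> \<beta> n w \<in> T n"
  using T_Suc[of n] unfolding Fac_def by blast

lemma start_Cons: "\<exists>u. \<beta> n (c # w) = a # u"
  using start[of n c] positive_Cons[OF \<beta>, of n c w] by auto

lemma T_prod: "m \<le> n \<Longrightarrow> T m = Fac (morphism_prod \<beta> m n ` T n)"
proof (induction n rule: dec_induct)
  case base
  show ?case using fact[of m] by (auto simp: Fac_def factorial_def)
next
  case (step n)
  have "morphism_prod \<beta> m (Suc n) = morphism_prod \<beta> m n \<circ> \<beta> n"
    using step(1) morphism_prod_split[of m n "Suc n" \<beta>] by (simp add: morphism_prod_def)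
  then have "Fac (morphism_prod \<beta> m (Suc n) ` T (Suc n)) = Fac (morphism_prod \<beta> m n ` Fac (\<beta> n ` T (Suc n)))"
    by (simp add: Fac_image_Fac[OF positive_morphism_prod[OF \<beta>]] image_comp)
  then show ?case by (subst step.IH, subst T_Suc[of n]) (rule sym)
qed

lemma prod_mem: "m \<le> n \<Longrightarrow> w \<in> T n \<Longrightarrow> morphism_prod \<beta> m n w \<in> T m"
  using T_prod unfolding Fac_def by blast

text \<open>Induction over the levels: one level up there is a power of a letter \<open>e'\<close>
  with image \<open>a\<close>, and the image of any letter that follows it contributes one more
  \<open>a\<close>.\<close>

lemma letter_fixed_power:
  "morphism_prod \<beta> j (j + k) [x] = [e] \<Longrightarrow> e # replicate k a \<in> T j \<and> (k > 0 \<longrightarrow> e = a)"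
proof (induction k arbitrary: j e)
  case 0
  then show ?case using letter by simp
next
  case (Suc k)
  let ?v = "morphism_prod \<beta> (Suc j) (Suc j + k) [x]"
  have v: "\<beta> j ?v = [e]" using Suc.prems morphism_prod_Suc_left[of j "j + Suc k" \<beta>] by simp
  have "length ?v \<le> 1" using positive_length_ge[OF \<beta>, of ?v j] v by simp
  moreover have "?v \<noteq> []" using v positive_Nil[OF \<beta>] by auto
  ultimately obtain e' where e': "?v = [e']" by (cases ?v) auto
  then have IH: "e' # replicate k a \<in> T (Suc j)" "k > 0 \<longrightarrow> e' = a" using Suc.IH by blast+
  have e: "\<beta> j [e'] = [a]" "e = a" using v e' start[of j e'] by auto
  have rep: "e' # replicate k a = replicate (Suc k) e'" using IH(2) by (cases k) auto
  have \<beta>rep: "\<beta> j (replicate i e') = replicate i a" for i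
    by (induction i) (simp_all add: positive_Nil[OF \<beta>] positive_Cons[OF \<beta>, of j e' "replicate _ e'"] e)
  obtain y where "(e' # replicate k a) @ [y] \<in> T (Suc j)" using right_extend[OF fact bi IH(1)] by blast
  then have "\<beta> j (replicate (Suc k) e' @ [y]) \<in> T j" using \<beta>_mem rep by simp
  then have "replicate (Suc k) a @ \<beta> j [y] \<in> T j" using positive_append[OF \<beta>] \<beta>rep by metis
  moreover obtain u where "\<beta> j [y] = a # u" using start by blast
  ultimately have "(replicate (Suc k) a @ [a]) @ u \<in> T j" by simp
  then have "replicate (Suc k) a @ [a] \<in> T j" by (rule factorial_prefix[OF fact])
  then have "a # replicate (Suc k) a \<in> T j" by (simp add: replicate_append_same)
  then show ?case using e by simp
qed

text \<open>An image of length one under \<open>k\<close> blocks would put the \<open>k\<close>-th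
  power of \<open>a\<close> into \<open>T m\<close>, which fails for a suitable
  \<open>k\<close>.\<close>

lemma doubling: "\<exists>n>m. \<forall>c. 2 \<le> length (morphism_prod \<beta> m n [c])"
proof -
  obtain k where k: "replicate k a \<notin> T m" using power_not_mem[OF T ab] by blast
  have "k \<noteq> 0" using k letter[of a m] factorial_prefix[OF fact, of "[]" "[a]"] by (intro notI) simp
  have "2 \<le> length (morphism_prod \<beta> m (m + k) [c])" for c
  proof (rule ccontr)
    let ?v = "morphism_prod \<beta> m (m + k) [c]"
    assume "\<not> 2 \<le> length ?v"
    moreover have "1 \<le> length ?v"
      using positive_length_ge[OF positive_morphism_prod[OF \<beta>], where w = "[c]"] by simp
    ultimately obtain e where "?v = [e]" by (cases ?v; cases "tl ?v") auto
    then have "e # replicate k a \<in> T m" using letter_fixed_power by blast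
    then show False using k factorial_tl[OF fact] by blast
  qed
  then show ?thesis using \<open>k \<noteq> 0\<close> by (intro exI[of _ "m + k"]) auto
qed

lemma growth: "\<exists>n>m. \<forall>c. N < length (morphism_prod \<beta> m n [c])"
proof (induction N)
  case 0
  show ?case using doubling[of m] by (meson less_le_trans zero_less_numeral)
next
  case (Suc N)
  then obtain n where n: "m < n" "\<And>c. N < length (morphism_prod \<beta> m n [c])" by blast
  obtain n' where n': "n < n'" "\<And>c. 2 \<le> length (morphism_prod \<beta> n n' [c])" using doubling by blast
  have "Suc N < length (morphism_prod \<beta> m n' [c])" for c
  proof -
    have "Suc N < Suc N * 2" by simp
    also have "\<dots> \<le> Suc N * length (morphism_prod \<beta> n n' [c])" using n' by (intro mult_le_mono) auto
    also have "\<dots> \<le> length (morphism_prod \<beta> m n (morphism_prod \<beta> n n' [c]))"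
      using n by (intro positive_length positive_morphism_prod \<beta>) (simp add: Suc_le_eq)
    finally show ?thesis using morphism_prod_split[of m n n' \<beta>] n n' by simp
  qed
  then show ?case using n n' by (intro exI[of _ n']) auto
qed

text \<open>
  Every block image starts with \<open>a\<close>, so the two letters around a border between two block images
  already occur in a word of \<open>T n\<close>, even if the blocks are in an arbitrary order.
\<close>

lemma short_factor_mem: "sublist u (\<beta> n v) \<Longrightarrow> length u \<le> 2 \<Longrightarrow> u \<in> T n"
proof (induction v)
  case Nil
  then show ?case using positive_Nil[OF \<beta>] letter factorial_prefix[OF fact, of "[]" "[a]"] by simp
next
  case (Cons c v)
  have mem: "w \<in> T n" if "sublist w (\<beta> n [c])" for w
    using that \<beta>_mem[OF letter] fact[of n] unfolding factorial_def by blast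
  have "sublist u (\<beta> n [c] @ \<beta> n v)" using Cons.prems(1) positive_Cons[OF \<beta>, of n c v] by simp
  then consider "sublist u (\<beta> n [c])" | "sublist u (\<beta> n v)"
    | u1 u2 where "u = u1 @ u2" "suffix u1 (\<beta> n [c])" "prefix u2 (\<beta> n v)"
    unfolding sublist_append by blast
  then show ?case
  proof cases
    case 1
    then show ?thesis by (rule mem)
  next
    case 2
    then show ?thesis using Cons by blast
  next
    case 3
    show ?thesis
    proof (cases "u1 = [] \<or> u2 = []")
      case True
      then show ?thesis using 3 mem Cons.IH Cons.prems(2)
        by (auto simp: suffix_imp_sublist prefix_imp_sublist)
    next
      case False
      then have "length u2 = 1" using 3(1) Cons.prems(2) by (cases u1; cases u2) auto
      moreover have "v \<noteq> []" using 3(3) False positive_Nil[OF \<beta>] by auto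
      then have "\<exists>r. \<beta> n v = a # r" using start_Cons by (cases v) auto
      ultimately have "u2 = [a]" using 3(3) by (cases u2) auto
      obtain d where "[c] @ [d] \<in> T (Suc n)" using right_extend[OF fact bi letter] by blast
      then have "\<beta> n [c] @ \<beta> n [d] \<in> T n" using \<beta>_mem positive_append[OF \<beta>] by metis
      moreover obtain r where "\<beta> n [d] = a # r" using start by blast
      moreover obtain p where "\<beta> n [c] = p @ u1" using 3(2) unfolding suffix_def by blast
      ultimately have "p @ (u1 @ u2) @ r \<in> T n" using \<open>u2 = [a]\<close> by simp
      then show ?thesis using 3(1) factorialD[OF fact] by blast
    qed
  qed
qed

text \<open>Once the letter images under the first \<open>n\<close> blocks are longer than
  \<open>w\<close>, the word \<open>w\<close> lies in the image of a factor of
  \<open>\<beta> n v\<close> of length at most two. Such factors belong to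
  \<open>T n\<close>.\<close>

lemma limit_subset:
  assumes "\<And>n. w \<in> Fac (range (morphism_prod \<beta> 0 n))"
  shows "w \<in> T 0"
proof -
  obtain n where n: "\<And>c. length w < length (morphism_prod \<beta> 0 n [c])" using growth by blast
  let ?f = "morphism_prod \<beta> 0 n"
  obtain v where "sublist w (morphism_prod \<beta> 0 (Suc n) v)" using assms[of "Suc n"] unfolding Fac_def by blast
  then have "sublist w (?f (\<beta> n v))"
    using morphism_prod_split[of 0 n "Suc n" \<beta>] by (simp add: morphism_prod_def)
  then obtain u where u: "sublist u (\<beta> n v)" "length u \<le> 2" "sublist w (?f u)"
    using short_factor[OF positive_morphism_prod[OF \<beta>], of w] n by (meson less_imp_le)
  then have "?f u \<in> T 0" using short_factor_mem prod_mem by blast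
  then show ?thesis using u(3) fact unfolding factorial_def by blast
qed

end

section \<open>From blocks to single morphisms\<close>

lemma foldr_comp_concat:
  "foldr (\<circ>) (concat fss) id = foldr (\<circ>) (map (\<lambda>fs. foldr (\<circ>) fs id) fss) id"
proof (induction fss)
  case (Cons fs fss)
  have "foldr (\<circ>) (f # gs) id = f \<circ> foldr (\<circ>) gs id" for f :: "'a \<Rightarrow> 'a" and gs by simp
  then show ?case by (simp only: concat.simps list.map foldr_comp_append Cons.IH)
qed simp

text \<open>The blocks are concatenated, and \<open>k n\<close> is the number of morphisms in the
  first \<open>n\<close> of them, so products between such indices consist of whole blocks.\<close>

lemma flatten_blocks:
  fixes bl :: "nat \<Rightarrow> ('a list \<Rightarrow> 'a list) list"
  assumes ne: "\<And>n. bl n \<noteq> []"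
  obtains \<sigma> and k :: "nat \<Rightarrow> nat"
  where "\<And>j. \<exists>n. \<sigma> j \<in> set (bl n)" "\<And>n. n \<le> k n" "mono k"
    "k 0 = 0"
    "\<And>m n. m \<le> n \<Longrightarrow> morphism_prod \<sigma> (k m) (k n) = morphism_prod (\<lambda>n. foldr (\<circ>) (bl n) id) m n"
proof -
  define L where "L n = concat (map bl [0..<n])" for n
  \<comment> \<open>Blocks are nonempty, so \<open>L (Suc j)\<close> has more than \<open>j\<close>
    entries; every other list \<open>L n\<close> with more than \<open>j\<close> entries agrees with
    it there.\<close>
  define \<sigma> where "\<sigma> j = L (Suc j) ! j" for j
  have L_split: "L n = L m @ concat (map bl [m..<n])" if "m \<le> n" for m n
  proof -
    have "[0..<n] = [0..<m] @ [m..<n]" using that by (metis le_add_diff_inverse upt_add_eq_append zero_le)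
    then show ?thesis unfolding L_def by simp
  qed
  have len: "n \<le> length (L n)" for n
  proof (induction n)
    case (Suc n)
    have "1 \<le> length (bl n)" using ne[of n] by (cases "bl n") auto
    moreover have "length (L (Suc n)) = length (L n) + length (bl n)" using L_split[of n "Suc n"] by simp
    ultimately show ?case using Suc by linarith
  qed simp
  have nth: "\<sigma> j = L n ! j" if j: "j < length (L n)" for j n
  proof (cases "Suc j \<le> n")
    case True
    then show ?thesis using L_split[OF True] len[of "Suc j"] by (simp add: \<sigma>_def nth_append)
  next
    case False
    then have "n \<le> Suc j" by simp
    then show ?thesis using L_split[of n "Suc j"] j by (simp add: \<sigma>_def nth_append)
  qed
  have map: "map \<sigma> [0..<length (L n)] = L n" for n
    by (rule nth_equalityI) (simp_all add: nth)
  have mono: "length (L m) \<le> length (L n)" if "m \<le> n" for m n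
    using L_split[OF that] by simp
  have seg: "map \<sigma> [length (L m)..<length (L n)] = concat (map bl [m..<n])" if "m \<le> n" for m n
  proof -
    have "[0..<length (L n)] = [0..<length (L m)] @ [length (L m)..<length (L n)]"
      using mono[OF that] by (metis le_add_diff_inverse upt_add_eq_append zero_le)
    then have "L n = L m @ map \<sigma> [length (L m)..<length (L n)]" using map by (metis map_append)
    then show ?thesis using L_split[OF that] by simp
  qed
  show ?thesis
  proof (rule that[of \<sigma> "\<lambda>n. length (L n)"])
    show "\<exists>n. \<sigma> j \<in> set (bl n)" for j
    proof -
      have "\<sigma> j \<in> set (L (Suc j))" unfolding \<sigma>_def using len[of "Suc j"] by (intro nth_mem) simp
      then show ?thesis unfolding L_def by auto
    qed
    show "n \<le> length (L n)" for n by (rule len)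
    show "mono (\<lambda>n. length (L n))" by (rule monoI) (rule mono)
    show "morphism_prod \<sigma> (length (L m)) (length (L n)) = morphism_prod (\<lambda>n. foldr (\<circ>) (bl n) id) m n"
      if "m \<le> n" for m n
      unfolding morphism_prod_def seg[OF that] foldr_comp_concat map_map o_def[of "\<lambda>fs. foldr _ fs _"] ..
    show "length (L 0) = 0" by (simp add: L_def)
  qed
qed

text \<open>Here no letter differs from \<open>a\<close> and nothing need grow; but there is only
  one word of each length, so \<open>T\<close> contains all words and the identity serves at every
  index.\<close>

lemma sadic_one_letter:
  fixes T :: "'a list set"
  assumes one: "\<And>a b :: 'a. a = b" and T: "factorial T" "right_extendable T" "T \<noteq> {}"
  shows "\<exists>\<sigma>. sadic_representation elementary_positive T \<sigma> \<and> primitive_sequence \<sigma>"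
proof -
  let ?\<sigma> = "\<lambda>_ :: nat. id :: 'a list \<Rightarrow> 'a list"
  have "word_morphism (\<lambda>c. [id c]) w = w" for w :: "'a list" by (induction w) simp_all
  then have "perm_morphism id = (id :: 'a list \<Rightarrow> 'a list)"
    unfolding perm_morphism_def by (intro ext) simp
  moreover have "perm_morphism id \<in> (elementary_positive :: ('a list \<Rightarrow> 'a list) set)"
    unfolding elementary_positive_def using bij_id by blast
  ultimately have "(id :: 'a list \<Rightarrow> 'a list) \<in> elementary_positive" by simp
  moreover have "foldr (\<circ>) (replicate n id) id = (id :: 'a list \<Rightarrow> 'a list)" for n
    by (induction n) simp_all
  then have prod: "morphism_prod ?\<sigma> r s = id" for r s
    by (simp add: morphism_prod_def map_replicate_const)
  have "T = UNIV"
  proof -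
    have "\<exists>v\<in>T. length v = n" for n
    proof (induction n)
      case 0
      obtain v where "v \<in> T" using T(3) by blast
      then have "[] \<in> T" using T(1) unfolding factorial_def by blast
      then show ?case by auto
    next
      case (Suc n)
      then obtain v where "v \<in> T" "length v = n" by blast
      moreover from this obtain c where "v @ [c] \<in> T" using T(2) unfolding right_extendable_def by blast
      ultimately show ?case by (intro bexI[of _ "v @ [c]"]) auto
    qed
    moreover have "v = w" if "length v = length w" for v w :: "'a list"
      using that one by (intro nth_equalityI) auto
    ultimately show ?thesis by (metis UNIV_eq_I)
  qed
  then have "T = (\<Inter>n. Fac (range (morphism_prod ?\<sigma> 0 (Suc n))))"
    unfolding prod by (auto simp: Fac_def)
  ultimately have "sadic_representation elementary_positive T ?\<sigma>"
    unfolding sadic_representation_def by blast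
  moreover have "primitive_sequence ?\<sigma>"
    unfolding primitive_sequence_def prod using one by auto
  ultimately show ?thesis by blast
qed

theorem theorem5p23:
  fixes T :: "'a::finite list set"
  assumes "uniformly_recurrent T"
    and "tree_set T"
    and "\<forall>a. [a] \<in> T"
  shows "\<exists>\<sigma>. sadic_representation elementary_positive T \<sigma> \<and> primitive_sequence \<sigma>"
proof (cases "\<exists>a b :: 'a. b \<noteq> a")
  case False
  then show ?thesis
    using sadic_one_letter[of T] assms(1) unfolding uniformly_recurrent_def by blast
next
  case True
  then obtain a b :: 'a where ab: "b \<noteq> a" by blast
  have T: "recurrent_dendric T"
    using assms tree_set_gtree unfolding recurrent_dendric_def uniformly_recurrent_def tree_set_def by blast
  \<comment> \<open>The implication stands below the quantifiers so that choice yields total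
    functions: \<open>F\<close> for the block and \<open>G\<close> for the desubstituted
    set.\<close>
  have "\<forall>T'. \<exists>ss T''. recurrent_dendric (T' :: 'a list set) \<longrightarrow>
      set ss \<subseteq> elementary_positive \<and> ss \<noteq> [] \<and> recurrent_dendric T'' \<and>
      T' = Fac (foldr (\<circ>) ss id ` T'') \<and> (\<forall>c. \<exists>u. foldr (\<circ>) ss id [c] = a # u)"
    using block_exists[OF _ ab] by blast
  then obtain F G where FG: "\<And>T' :: 'a list set. recurrent_dendric T' \<Longrightarrow>
      set (F T') \<subseteq> elementary_positive \<and> F T' \<noteq> [] \<and> recurrent_dendric (G T') \<and>
      T' = Fac (foldr (\<circ>) (F T') id ` G T') \<and> (\<forall>c. \<exists>u. foldr (\<circ>) (F T') id [c] = a # u)"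
    by metis
  define Ts where "Ts n = (G ^^ n) T" for n
  define bl where "bl n = F (Ts n)" for n
  define \<beta> where "\<beta> = (\<lambda>n. foldr (\<circ>) (bl n) id)"
  have Ts: "recurrent_dendric (Ts n)" for n
    by (induction n) (use T FG in \<open>auto simp: Ts_def\<close>)
  have bl: "set (bl n) \<subseteq> elementary_positive" "bl n \<noteq> []" for n
    using FG[OF Ts] unfolding bl_def by blast+
  interpret block_sequence Ts \<beta> a b
  proof
    show "positive (\<beta> n)" for n
      unfolding \<beta>_def using bl(1) positive_elementary by (intro positive_foldr) blast
    show "Ts n = Fac (\<beta> n ` Ts (Suc n))" for n
      using FG[OF Ts[of n]] unfolding \<beta>_def bl_def by (simp add: Ts_def)
    show "\<exists>u. \<beta> n [c] = a # u" for n c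
      using FG[OF Ts[of n]] unfolding \<beta>_def bl_def by blast
  qed (use Ts ab in auto)
  obtain \<sigma> k where \<sigma>: "\<And>j. \<exists>n. \<sigma> j \<in> set (bl n)" and k: "\<And>n. n \<le> k n" "mono k" "k 0 = 0"
    and prod: "\<And>m n. m \<le> n \<Longrightarrow> morphism_prod \<sigma> (k m) (k n) = morphism_prod \<beta> m n"
    by (rule flatten_blocks[of bl, OF bl(2), folded \<beta>_def]) blast
  have \<sigma>_elem: "\<sigma> n \<in> elementary_positive" for n using \<sigma> bl(1) by blast
  have pos: "positive (morphism_prod \<sigma> r s)" for r s
    using \<sigma>_elem positive_elementary by (intro positive_morphism_prod) blast
  have "T = (\<Inter>n. Fac (range (morphism_prod \<sigma> 0 (Suc n))))"
  proof
    show "T \<subseteq> (\<Inter>n. Fac (range (morphism_prod \<sigma> 0 (Suc n))))"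
    proof (intro subsetI INT_I)
      fix w n assume "w \<in> T"
      then have "w \<in> Fac (morphism_prod \<beta> 0 (Suc n) ` Ts (Suc n))" using T_prod[of 0 "Suc n"] by (simp add: Ts_def)
      then obtain v where v: "sublist w (morphism_prod \<sigma> 0 (k (Suc n)) v)"
        using prod[of 0 "Suc n"] k(3) unfolding Fac_def by auto
      \<comment> \<open>The index \<open>Suc n\<close> may fall inside a block; the product is
        prolonged to the border \<open>k (Suc n)\<close>.\<close>
      have "morphism_prod \<sigma> 0 (k (Suc n)) = morphism_prod \<sigma> 0 (Suc n) \<circ> morphism_prod \<sigma> (Suc n) (k (Suc n))"
        using k(1) by (intro morphism_prod_split) auto
      then have "sublist w (morphism_prod \<sigma> 0 (Suc n) (morphism_prod \<sigma> (Suc n) (k (Suc n)) v))"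
        using v by simp
      then show "w \<in> Fac (range (morphism_prod \<sigma> 0 (Suc n)))" unfolding Fac_def by blast
    qed
    show "(\<Inter>n. Fac (range (morphism_prod \<sigma> 0 (Suc n)))) \<subseteq> T"
    proof
      fix w assume w: "w \<in> (\<Inter>n. Fac (range (morphism_prod \<sigma> 0 (Suc n))))"
      \<comment> \<open>\<open>k n = 0\<close> forces \<open>n = 0\<close>, where the product is the
        identity and every word qualifies.\<close>
      have "w \<in> Fac (range (morphism_prod \<beta> 0 n))" for n
      proof (cases "k n")
        case 0
        then show ?thesis using k(1)[of n] by (auto simp: Fac_def)
      next
        case (Suc j)
        then have "morphism_prod \<beta> 0 n = morphism_prod \<sigma> 0 (Suc j)" using prod[of 0 n] k(3) by simp
        then show ?thesis using w by (metis INT_D UNIV_I)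
      qed
      then show "w \<in> T" using limit_subset by (simp add: Ts_def)
    qed
  qed
  then have "sadic_representation elementary_positive T \<sigma>"
    unfolding sadic_representation_def using \<sigma>_elem by blast
  moreover have "primitive_sequence \<sigma>" unfolding primitive_sequence_def
  proof
    fix r
    \<comment> \<open>The blocks from \<open>r\<close> on are composed until letter images are long
      words of \<open>Ts r\<close>, which contain all letters. The product from \<open>r\<close> to
      the border \<open>k r\<close> keeps this property.\<close>
    obtain N where N: "\<And>w b. w \<in> Ts r \<Longrightarrow> N \<le> length w \<Longrightarrow> b \<in> set w"
      using long_words_contain_letters[OF Ts[of r]] by blast
    obtain n where n: "r < n" "\<And>c. N < length (morphism_prod \<beta> r n [c])" using growth by blast
    have "d \<in> set (morphism_prod \<sigma> r (k n) [c])" for c d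
    proof -
      have split: "morphism_prod \<sigma> r (k n) = morphism_prod \<sigma> r (k r) \<circ> morphism_prod \<sigma> (k r) (k n)"
        using k(1)[of r] monoD[OF k(2), of r n] n(1) by (intro morphism_prod_split) auto
      obtain e where e: "d \<in> set (morphism_prod \<sigma> r (k r) [e])"
        using pos[of r "k r"] unfolding positive_def by blast
      have "e \<in> set (morphism_prod \<beta> r n [c])"
        using N prod_mem[of r n "[c]"] letter n by (meson less_imp_le)
      then have "d \<in> set (morphism_prod \<sigma> r (k r) (morphism_prod \<beta> r n [c]))"
        using e positive_mem[OF pos, of d r "k r"] by blast
      then show ?thesis using split prod[of r n] n(1) by simp
    qed
    then show "\<exists>s>r. \<forall>a b. b \<in> set (morphism_prod \<sigma> r s [a])"
      using n(1) k(1)[of n] by (intro exI[of _ "k n"]) auto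
  qed
  ultimately show ?thesis by blast
qed

end
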